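(* Let $\mathcal H$ be a Hilbert space, $\Delta$ a self-adjoint positive definite operator in $\mathcal H$, $D=\Delta^{1/2}$, and $PW_\omega=PW_\omega(D)$. Then for every $f\in\mathcal H$ there exist a sequence of bandlimited vectors $f_j=f_j(f)\in PW_{2^{j+1}}$ ($j=0,1,2,\dots$) and a vector $g=g(f)\in PW_1$ such that, for every $\alpha>0$ and $1\le q<\infty$, the Besov norm $\|f\|_{B^\alpha_{2,q}}$ is equivalent to each of $$\|g\|+\Big(\sum_{j=0}^\infty(2^{j\alpha}\|f_j\|)^q\Big)^{1/q}\qquad\text{and}\qquad \|f\|+\Big(\sum_{j=0}^\infty(2^{j\alpha}\|f_j\|)^q\Big)^{1/q},$$ and the same holds for $q=\infty$ with the sums replaced by $\sup_{j\ge0}2^{j\alpha}\|f_j\|$. Here equivalence means that each quantity is bounded by a constant multiple of the other, with constants independent of $f\in\mathcal H$ (and that $f\in B^\alpha_{2,q}$ if and only if these quantities are finite).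
   Context: $\Delta$ is a self-adjoint, positive definite (in general unbounded) operator whose spectral measure is concentrated on $(0,\infty)$ (in particular $\{0\}$ has zero spectral projection). $\|\cdot\|$ is the norm of $\mathcal H$. For $\omega>0$, the Paley–Wiener space $PW_\omega(D)$ is the set of $f\in\mathcal H$ such that the support of the spectral Fourier transform $\mathcal F_Df$ is contained in $[0,\omega]$; here $\mathcal F_D$ is a unitary map from $\mathcal H$ onto a direct integral $X=\int X(\lambda)\,dm(\lambda)$ over $[0,\infty)$, which maps the domain of $D^k$ onto $\{x\in X:\lambda^kx\in X\}$ with $\mathcal F_D(D^kf)=\lambda^k\mathcal F_Df$. Equivalently, $PW_\omega(D)$ is the range of the spectral projection of $D$ for $[0,\omega]$. Its elements are called bandlimited. Besov space: $B^\alpha_{2,q}=B^\alpha_{2,q}(\Delta)=(\mathcal H,\mathcal D(\Delta^{r/2}))^K_{\alpha/r,q}$ with $r$ any natural number satisfying $r>\alpha$: with $K(t,f)=\inf_{g\in\mathcal D(\Delta^{r/2})}(\|f-g\|+t(\|g\|+\|\Delta^{r/2}g\|))$, the norm is $\|f\|_{B^\alpha_{2,q}}=\|f\|+\big(\int_0^\infty(t^{-\alpha/r}K(t,f))^q\frac{dt}{t}\big)^{1/q}$ for $q<\infty$ and $\|f\|+\sup_{t>0}t^{-\alpha/r}K(t,f)$ for $q=\infty$ (value $+\infty$ allowed); $B^\alpha_{2,q}$ is the set of $f\in\mathcal H$ with finite norm. Different $r$ give equivalent norms. *)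

theory Defs
  imports "HOL-Analysis.Analysis"
begin

section \<open>Unbounded operators\<close>

text \<open>
  A Hilbert space is a type of class real_inner and complete_space.  Complex Hilbert spaces are
  covered by restriction of scalars, taking the real part of the inner product: norm, domains,
  self-adjointness, the spectral measure and the operators built from it do not change.

  An operator that is defined on a part of the space only is a partial function, so that equality
  of operators includes equality of their domains.
\<close>

type_synonym 'a operator = "'a \<rightharpoonup> 'a"

abbreviation app :: "'a operator \<Rightarrow> 'a \<Rightarrow> 'a"
  where "app A x \<equiv> the (A x)"

definition linear_operator :: "'a::real_vector operator \<Rightarrow> bool"
  where "linear_operator A \<longleftrightarrow> subspace (dom A) \<and>
    (\<forall>x\<in>dom A. \<forall>y\<in>dom A. app A (x + y) = app A x + app A y) \<and>
    (\<forall>c. \<forall>x\<in>dom A. app A (c *\<^sub>R x) = c *\<^sub>R app A x)"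

text \<open>For densely defined operators the vector chosen by THE is unique.\<close>

definition adjoint_operator :: "'a::real_inner operator \<Rightarrow> 'a operator"
  where "adjoint_operator A x =
    (if \<exists>z. \<forall>y\<in>dom A. inner (app A y) x = inner y z
     then Some (THE z. \<forall>y\<in>dom A. inner (app A y) x = inner y z)
     else None)"

definition self_adjoint :: "'a::real_inner operator \<Rightarrow> bool"
  where "self_adjoint A \<longleftrightarrow>
    linear_operator A \<and> closure (dom A) = UNIV \<and> adjoint_operator A = A"

text \<open>
  For a self-adjoint operator, strict positivity of the quadratic form says that the spectral
  measure is concentrated on the open half-line of positive numbers.
\<close>

definition positive_definite :: "'a::real_inner operator \<Rightarrow> bool"
  where "positive_definite A \<longleftrightarrow> (\<forall>x\<in>dom A. x \<noteq> 0 \<longrightarrow> 0 < inner (app A x) x)"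


section \<open>Spectral measures and functions of an operator\<close>

definition orthogonal_projection :: "('a::real_inner \<Rightarrow> 'a) \<Rightarrow> bool"
  where "orthogonal_projection P \<longleftrightarrow>
    bounded_linear P \<and> (\<forall>x. P (P x) = P x) \<and> (\<forall>x y. inner (P x) y = inner x (P y))"

definition projection_valued_measure :: "(real set \<Rightarrow> 'a::real_inner \<Rightarrow> 'a) \<Rightarrow> bool"
  where "projection_valued_measure E \<longleftrightarrow>
    (\<forall>B\<in>sets borel. orthogonal_projection (E B)) \<and>
    E UNIV = id \<and>
    (\<forall>A\<in>sets borel. \<forall>B\<in>sets borel. E (A \<inter> B) = E A \<circ> E B) \<and>
    (\<forall>B :: nat \<Rightarrow> real set. range B \<subseteq> sets borel \<longrightarrow> disjoint_family B \<longrightarrow>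
      (\<forall>x. (\<lambda>n. E (B n) x) sums E (\<Union>n. B n) x))"

text \<open>The finite Borel measure that maps \<open>B\<close> to \<open>\<langle>E B x, x\<rangle>\<close>.\<close>

definition scalar_measure :: "(real set \<Rightarrow> 'a::real_inner \<Rightarrow> 'a) \<Rightarrow> 'a \<Rightarrow> real measure"
  where "scalar_measure E x = measure_of UNIV (sets borel) (\<lambda>B. ennreal (inner (E B x) x))"

text \<open>
  The operator \<open>\<integral> \<phi> dE\<close>: its domain consists of the \<open>x\<close> for which \<open>\<phi>\<close> is square integrable with
  respect to \<open>\<langle>E x, x\<rangle>\<close>, and \<open>\<langle>(\<integral> \<phi> dE) x, z\<rangle>\<close> is the integral of \<open>\<phi>\<close> with respect to the
  signed measure \<open>\<langle>E x, z\<rangle>\<close>, obtained here by polarization.  Testing with \<open>z\<close> in the domain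
  makes both integrals finite, and it is enough because the domain is dense.
\<close>

definition spectral_integral ::
    "(real set \<Rightarrow> 'a::real_inner \<Rightarrow> 'a) \<Rightarrow> (real \<Rightarrow> real) \<Rightarrow> 'a operator"
  where "spectral_integral E \<phi> =
    (let S = {x. (\<integral>\<^sup>+ t. ennreal ((\<phi> t)\<^sup>2) \<partial>scalar_measure E x) < \<infinity>}
     in (\<lambda>x. if x \<in> S
             then Some (THE y. \<forall>z\<in>S. inner y z =
               ((\<integral>t. \<phi> t \<partial>scalar_measure E (x + z)) -
                (\<integral>t. \<phi> t \<partial>scalar_measure E (x - z))) / 4)
             else None))"

text \<open>By the spectral theorem every self-adjoint operator has a spectral measure; it is unique
  on Borel sets.\<close>

definition spectral_measure_of ::
    "(real set \<Rightarrow> 'a::real_inner \<Rightarrow> 'a) \<Rightarrow> 'a operator \<Rightarrow> bool"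
  where "spectral_measure_of E A \<longleftrightarrow>
    projection_valued_measure E \<and> spectral_integral E (\<lambda>t. t) = A"

text \<open>The power \<open>A\<^sup>s\<close> of the positive definite operator \<open>A\<close> with spectral measure \<open>E\<close>.\<close>

definition operator_powr ::
    "(real set \<Rightarrow> 'a::real_inner \<Rightarrow> 'a) \<Rightarrow> real \<Rightarrow> 'a operator"
  where "operator_powr E s = spectral_integral E (\<lambda>t. t powr s)"

definition paley_wiener :: "'a::real_inner operator \<Rightarrow> real \<Rightarrow> 'a set"
  where "paley_wiener D \<omega> = {f. \<exists>F. spectral_measure_of F D \<and> f \<in> range (F {0..\<omega>})}"


section \<open>Besov norms\<close>

definition K_functional :: "'a::real_normed_vector operator \<Rightarrow> real \<Rightarrow> 'a \<Rightarrow> real"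
  where "K_functional A t f =
    (INF g\<in>dom A. norm (f - g) + t * (norm g + norm (app A g)))"

definition ennreal_powr :: "ennreal \<Rightarrow> real \<Rightarrow> ennreal"
  where "ennreal_powr x a = (if x = \<infinity> then \<infinity> else ennreal (enn2real x powr a))"

text \<open>
  The norm of the real interpolation space \<open>(H, D(A))\<^sup>K\<close> with parameters \<open>\<theta>\<close> and \<open>q\<close>, for
  \<open>1 \<le> q \<le> \<infinity>\<close>; the value is infinite outside of the space.
\<close>

definition interpolation_norm ::
    "'a::real_normed_vector operator \<Rightarrow> real \<Rightarrow> ennreal \<Rightarrow> 'a \<Rightarrow> ennreal"
  where "interpolation_norm A \<theta> q f = ennreal (norm f) +
    (if q = \<infinity> then (SUP t\<in>{0<..}. ennreal (t powr (- \<theta>) * K_functional A t f))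
     else ennreal_powr
       (\<integral>\<^sup>+ t\<in>{0<..}. ennreal ((t powr (- \<theta>) * K_functional A t f) powr enn2real q / t) \<partial>lborel)
       (1 / enn2real q))"

text \<open>
  \<open>E\<close> is the spectral measure of \<open>\<Delta>\<close> and \<open>r > \<alpha>\<close> is the natural number used for the
  interpolation between \<open>H\<close> and the domain of \<open>\<Delta>\<^bsup>r/2\<^esup>\<close>.
\<close>

definition besov_norm ::
    "(real set \<Rightarrow> 'a::real_inner \<Rightarrow> 'a) \<Rightarrow> nat \<Rightarrow> real \<Rightarrow> ennreal \<Rightarrow> 'a \<Rightarrow> ennreal"
  where "besov_norm E r \<alpha> q = interpolation_norm (operator_powr E (real r / 2)) (\<alpha> / real r) q"

definition besov_space ::
    "(real set \<Rightarrow> 'a::real_inner \<Rightarrow> 'a) \<Rightarrow> nat \<Rightarrow> real \<Rightarrow> ennreal \<Rightarrow> 'a set"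
  where "besov_space E r \<alpha> q = {f. besov_norm E r \<alpha> q f < \<infinity>}"

text \<open>The weighted \<open>\<ell>\<^sup>q\<close> norm of a sequence of vectors, with weights \<open>2\<^bsup>j\<alpha>\<^esup>\<close>.\<close>

definition dyadic_norm :: "real \<Rightarrow> ennreal \<Rightarrow> (nat \<Rightarrow> 'a::real_normed_vector) \<Rightarrow> ennreal"
  where "dyadic_norm \<alpha> q u =
    (if q = \<infinity> then (SUP j. ennreal (2 powr (real j * \<alpha>) * norm (u j)))
     else ennreal_powr
       (\<Sum>j. ennreal ((2 powr (real j * \<alpha>) * norm (u j)) powr enn2real q))
       (1 / enn2real q))"

text \<open>Two functionals with values in \<open>[0, \<infinity>]\<close> bound each other up to a constant; in particular
  they are finite at the same points.\<close>

definition equivalent_norms :: "('a \<Rightarrow> ennreal) \<Rightarrow> ('a \<Rightarrow> ennreal) \<Rightarrow> bool"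
  where "equivalent_norms M N \<longleftrightarrow>
    (\<exists>C>0. \<forall>f. M f \<le> ennreal C * N f \<and> N f \<le> ennreal C * M f)"

end

theory Submission
  imports Defs
begin

text \<open>
  Let \<open>F\<close> be the image of \<open>E\<close> under the square root; it is the spectral measure of \<open>D\<close>, and
  \<open>\<Delta>\<close> to the power \<open>r/2\<close> is the integral of \<open>t\<^sup>r\<close> with respect to \<open>F\<close>.  Cut \<open>f\<close> sharply:
  \<open>g = F[0,1]f\<close> and \<open>f\<^sub>j = F(2\<^sup>j,2\<^bsup>j+1\<^esup>]f\<close>.  As the operator is at least \<open>2\<^bsup>jr\<^esup>\<close> on the range
  of \<open>F(2\<^sup>j,2\<^bsup>j+1\<^esup>]\<close>, the norm of \<open>f\<^sub>j\<close> is at most \<open>K(2\<^bsup>-jr\<^esup>,f)\<close>.  Conversely, testing the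
  K-functional at \<open>t \<le> 2\<^bsup>-jr\<^esup>\<close> with \<open>F[0,2\<^sup>j]f\<close> bounds it by the pieces of \<open>f\<close>, with weights that
  decay geometrically away from the scale \<open>j\<close> because \<open>0 < \<alpha> < r\<close>.  Both comparisons are
  summed over the dyadic decomposition of the half-line of all \<open>t > 0\<close>.
\<close>

section \<open>Integrals with respect to projection-valued measures\<close>

text \<open>The pieces are cut from \<open>f\<close> by projections of \<open>F\<close> alone, so
  one choice serves all \<alpha>, q and r. The operators are given only through polarized integrals;
  what the estimates need is that the squared norm of the integral of \<phi> at x equals the
  integral of \<phi> squared against the scalar measure of x. With it, every bound concerns masses
  of finite measures. The obstacle is the sum over scales for finite q, usually handled by a
  discrete Hardy inequality. Here the margins \<alpha> and r - \<alpha> are halved: with \<epsilon>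
  = min(\<alpha>, r - \<alpha>)/2, the q-th powers of the coefficients, damped by 2^(-\<epsilon> q
  |i-j|), are added into one number for each scale j. Its q-th root bounds the i-th coefficient up
  to a growth 2^(\<epsilon> |i-j|), and the other half of the margin still gives a convergent
  geometric sum over i. Exchanging the sums over i and j costs only the factor 2/(1 - 2^(-\<epsilon>
  q)). For infinite q the supremum replaces the damped sum, and the same estimate of K
  applies.\<close>

locale pvm =
  fixes E :: "real set \<Rightarrow> 'a::real_inner \<Rightarrow> 'a"
  assumes pvm: "projection_valued_measure E"
begin

lemma orthogonal_projection: "B \<in> sets borel \<Longrightarrow> orthogonal_projection (E B)"
  using pvm by (simp add: projection_valued_measure_def)

lemma linear: "B \<in> sets borel \<Longrightarrow> linear (E B)"
  using orthogonal_projection by (auto simp: orthogonal_projection_def bounded_linear.linear)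

lemma UNIV [simp]: "E UNIV x = x"
  using pvm by (simp add: projection_valued_measure_def)

lemma compose: "A \<in> sets borel \<Longrightarrow> B \<in> sets borel \<Longrightarrow> E A (E B x) = E (A \<inter> B) x"
  using pvm by (simp add: projection_valued_measure_def)

lemma inner_eq:
  assumes "A \<in> sets borel" "B \<in> sets borel"
  shows "inner (E A x) (E B y) = inner (E (A \<inter> B) x) y"
proof -
  have "inner (E A x) (E B y) = inner (E B (E A x)) y"
    using orthogonal_projection[OF assms(2)] by (simp add: orthogonal_projection_def)
  then show ?thesis using assms by (simp add: compose Int_commute)
qed

lemma inner_self: "B \<in> sets borel \<Longrightarrow> inner (E B x) x = (norm (E B x))\<^sup>2"
  using inner_eq[of B B x x] by (simp add: power2_norm_eq_inner)

lemma sums: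
  "range B \<subseteq> sets borel \<Longrightarrow> disjoint_family B \<Longrightarrow> (\<lambda>n::nat. E (B n) x) sums E (\<Union>n. B n) x"
  using pvm by (simp add: projection_valued_measure_def)

text \<open>Countable additivity for the constant empty family gives a convergent series with equal
  terms, which forces the term to vanish.\<close>

lemma empty [simp]: "E {} x = 0"
proof -
  have "(\<lambda>n::nat. E {} x) sums E {} x"
    using sums[of "\<lambda>_. {}" x] by (simp add: disjoint_family_on_def)
  then show ?thesis
    using summable_LIMSEQ_zero[OF sums_summable] LIMSEQ_const_iff by blast
qed

lemma union:
  assumes "A \<in> sets borel" "B \<in> sets borel" "A \<inter> B = {}"
  shows "E (A \<union> B) x = E A x + E B x"
proof -
  have "(\<lambda>k. E (binaryset A B k) x) sums E (\<Union>k. binaryset A B k) x"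
    using assms by (intro sums) (auto simp: binaryset_def disjoint_family_on_def)
  moreover have "(\<lambda>k. E (binaryset A B k) x) sums (E A x + E B x)"
    by (rule binaryset_sums[of "\<lambda>B. E B x"]) simp
  ultimately show ?thesis by (simp add: UN_binaryset_eq sums_unique2)
qed

section \<open>The scalar measures of a projection-valued measure\<close>

lemma sets_scalar_measure [simp, measurable_cong]: "sets (scalar_measure E x) = sets borel"
  unfolding scalar_measure_def
  by (subst sets_measure_of) (auto simp: sets.sigma_sets_eq[of borel, unfolded space_borel])

lemma space_scalar_measure [simp]: "space (scalar_measure E x) = UNIV"
  unfolding scalar_measure_def by (subst space_measure_of) auto

text \<open>\<open>measure_of\<close> keeps the prescribed values only if they are countably
  additive. This follows from additivity in the Hilbert space norm, by continuity of the inner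
  product.\<close>

lemma emeasure_scalar_measure:
  assumes "B \<in> sets borel"
  shows "emeasure (scalar_measure E x) B = ennreal (inner (E B x) x)"
proof (rule emeasure_measure_of[OF scalar_measure_def])
  show "B \<in> sets (scalar_measure E x)" using assms by simp
  show "positive (sets (scalar_measure E x)) (\<lambda>B. ennreal (inner (E B x) x))"
    by (simp add: positive_def)
  show "countably_additive (sets (scalar_measure E x)) (\<lambda>B. ennreal (inner (E B x) x))"
  proof (rule countably_additiveI)
    fix A :: "nat \<Rightarrow> real set"
    assume A: "range A \<subseteq> sets (scalar_measure E x)" "disjoint_family A"
    then have "(\<lambda>n. inner (E (A n) x) x) sums inner (E (\<Union>n. A n) x) x"
      by (intro bounded_linear.sums[OF bounded_linear_inner_left] sums) auto
    moreover have "0 \<le> inner (E (A n) x) x" for n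
      using A by (auto simp: inner_self)
    ultimately show "(\<Sum>n. ennreal (inner (E (A n) x) x)) = ennreal (inner (E (\<Union> (range A)) x) x)"
      by (rule suminf_ennreal_eq[rotated])
  qed
qed auto

lemma measure_scalar_measure:
  "B \<in> sets borel \<Longrightarrow> measure (scalar_measure E x) B = inner (E B x) x"
  by (simp add: measure_def emeasure_scalar_measure inner_self)

lemma finite_scalar_measure: "finite_measure (scalar_measure E x)"
  by (rule finite_measureI) (simp add: emeasure_scalar_measure)

lemma norm_le: "B \<in> sets borel \<Longrightarrow> norm (E B x) \<le> norm x"
proof -
  assume B: "B \<in> sets borel"
  have "(norm (E B x))\<^sup>2 \<le> norm (E B x) * norm x"
    using norm_cauchy_schwarz[of "E B x" x] inner_self[OF B, of x] by simp
  then show ?thesis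
    by (cases "E B x = 0") (simp_all add: power2_eq_square)
qed

text \<open>The scalar measure is quadratic in the vector, not additive; the parallelogram law gives
  this substitute, from which domains are closed under sums.\<close>

lemma scalar_measure_add_le:
  assumes "B \<in> sets borel"
  shows "emeasure (scalar_measure E (x + y)) B
    \<le> 2 * emeasure (scalar_measure E x) B + 2 * emeasure (scalar_measure E y) B"
proof -
  have "(norm (E B (x + y)))\<^sup>2 \<le> 2 * (norm (E B x))\<^sup>2 + 2 * (norm (E B y))\<^sup>2"
  proof -
    have "(norm (E B x + E B y))\<^sup>2 + (norm (E B x - E B y))\<^sup>2 = 2 * (norm (E B x))\<^sup>2 + 2 * (norm (E B y))\<^sup>2"
      by (simp add: power2_norm_eq_inner algebra_simps)
    then show ?thesis
      using zero_le_power2[of "norm (E B x - E B y)"] unfolding linear_add[OF linear[OF assms]] by linarith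
  qed
  then have "ennreal ((norm (E B (x + y)))\<^sup>2) \<le> ennreal (2 * (norm (E B x))\<^sup>2 + 2 * (norm (E B y))\<^sup>2)"
    by (rule ennreal_leI)
  also have "\<dots> = 2 * ennreal ((norm (E B x))\<^sup>2) + 2 * ennreal ((norm (E B y))\<^sup>2)"
    by (simp add: ennreal_plus ennreal_mult)
  finally show ?thesis
    by (simp add: emeasure_scalar_measure[OF assms] inner_self[OF assms])
qed

lemma nn_integral_scalar_measure_add_le:
  fixes f :: "real \<Rightarrow> ennreal"
  assumes "f \<in> borel_measurable borel"
  shows "(\<integral>\<^sup>+t. f t \<partial>scalar_measure E (x + y))
    \<le> 2 * (\<integral>\<^sup>+t. f t \<partial>scalar_measure E x) + 2 * (\<integral>\<^sup>+t. f t \<partial>scalar_measure E y)"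
  using assms
proof (induction rule: borel_measurable_induct)
  case (cong f g)
  then show ?case by simp
next
  case (set A)
  then show ?case by (simp add: scalar_measure_add_le)
next
  case (mult u c)
  then have "c * (\<integral>\<^sup>+t. u t \<partial>scalar_measure E (x + y)) \<le>
     c * (2 * (\<integral>\<^sup>+t. u t \<partial>scalar_measure E x) + 2 * (\<integral>\<^sup>+t. u t \<partial>scalar_measure E y))"
    by (intro mult_left_mono) auto
  with mult(2) show ?case by (simp add: nn_integral_cmult algebra_simps)
next
  case (add u v)
  have "(\<integral>\<^sup>+t. u t \<partial>scalar_measure E (x + y)) + (\<integral>\<^sup>+t. v t \<partial>scalar_measure E (x + y)) \<le>
    (2 * (\<integral>\<^sup>+t. u t \<partial>scalar_measure E x) + 2 * (\<integral>\<^sup>+t. u t \<partial>scalar_measure E y)) +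
    (2 * (\<integral>\<^sup>+t. v t \<partial>scalar_measure E x) + 2 * (\<integral>\<^sup>+t. v t \<partial>scalar_measure E y))"
    using add by (intro add_mono) auto
  with add(1,3) show ?case by (simp add: nn_integral_add algebra_simps)
next
  case (seq U)
  have "(\<integral>\<^sup>+t. Sup (range U) t \<partial>scalar_measure E z) = (SUP i. \<integral>\<^sup>+t. U i t \<partial>scalar_measure E z)" for z
    unfolding SUP_apply
    using seq by (intro nn_integral_monotone_convergence_SUP) auto
  moreover have "(SUP i. \<integral>\<^sup>+t. U i t \<partial>scalar_measure E (x + y)) \<le>
     2 * (SUP i. \<integral>\<^sup>+t. U i t \<partial>scalar_measure E x) + 2 * (SUP i. \<integral>\<^sup>+t. U i t \<partial>scalar_measure E y)"
    by (rule SUP_least, rule order_trans, rule seq.IH, intro add_mono mult_left_mono SUP_upper) auto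
  ultimately show ?case by simp
qed

section \<open>Domains, and the norm formula for spectral integrals\<close>

definition domain :: "(real \<Rightarrow> real) \<Rightarrow> 'a set"
  where "domain \<phi> = {x. (\<integral>\<^sup>+ t. ennreal ((\<phi> t)\<^sup>2) \<partial>scalar_measure E x) < \<infinity>}"

lemma uminus_scalar_measure: "scalar_measure E (- x) = scalar_measure E x"
proof (rule measure_eqI)
  show "emeasure (scalar_measure E (- x)) A = emeasure (scalar_measure E x) A"
    if "A \<in> sets (scalar_measure E (- x))" for A
    using that by (simp add: emeasure_scalar_measure linear_neg[OF linear])
qed simp

lemma domain_add:
  assumes "\<phi> \<in> borel_measurable borel" "x \<in> domain \<phi>" "y \<in> domain \<phi>" shows "x + y \<in> domain \<phi>"
proof -
  have "2 * (\<integral>\<^sup>+t. ennreal ((\<phi> t)\<^sup>2) \<partial>scalar_measure E x) + 2 * (\<integral>\<^sup>+t. ennreal ((\<phi> t)\<^sup>2) \<partial>scalar_measure E y) < \<infinity>"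
    using assms(2,3) by (simp add: domain_def ennreal_mult_less_top)
  then show ?thesis
    unfolding domain_def mem_Collect_eq
    by (rule le_less_trans[OF nn_integral_scalar_measure_add_le, rotated]) (use assms(1) in measurable)
qed

lemma domain_diff:
  assumes "\<phi> \<in> borel_measurable borel" "x \<in> domain \<phi>" "y \<in> domain \<phi>" shows "x - y \<in> domain \<phi>"
  using domain_add[of \<phi> x "- y"] assms by (simp add: domain_def uminus_scalar_measure)

lemma integrable_square:
  assumes "\<phi> \<in> borel_measurable borel" "x \<in> domain \<phi>"
  shows "integrable (scalar_measure E x) (\<lambda>t. (\<phi> t)\<^sup>2)"
  using assms by (auto simp: integrable_iff_bounded domain_def)

text \<open>The scalar measure is finite, so square integrability is the stronger condition. Applied
  at x + z and x - z it makes the polarization formula in \<open>spectral_integral\<close>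
  meaningful.\<close>

lemma integrable:
  assumes "\<phi> \<in> borel_measurable borel" "x \<in> domain \<phi>"
  shows "integrable (scalar_measure E x) \<phi>"
proof -
  interpret finite_measure "scalar_measure E x" by (rule finite_scalar_measure)
  show ?thesis
    by (rule square_integrable_imp_integrable) (use assms integrable_square in \<open>simp_all add: measurable_cong_sets[OF sets_scalar_measure refl]\<close>)
qed

definition simple_integral :: "(real \<Rightarrow> real) \<Rightarrow> 'a \<Rightarrow> 'a"
  where "simple_integral s x = (\<Sum>c\<in>range s. c *\<^sub>R E (s -` {c}) x)"

lemma simple_vimage: "simple_function borel (s :: real \<Rightarrow> real) \<Longrightarrow> s -` {c} \<in> sets borel"
  using simple_functionD(2)[of borel s "{c}"] by simp

text \<open>The function \<open>h\<close> allows two uses: the identity for polarization, the square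
  for the norm.\<close>

lemma integral_simple:
  assumes s: "simple_function borel (s :: real \<Rightarrow> real)"
  shows "(\<integral>t. h (s t) \<partial>scalar_measure E x) = (\<Sum>c\<in>range s. h c * inner (E (s -` {c}) x) x)"
    "integrable (scalar_measure E x) (\<lambda>t. h (s t) :: real)"
proof -
  interpret finite_measure "scalar_measure E x" by (rule finite_scalar_measure)
  have fin: "finite (range s)" using simple_functionD(1)[OF s] by simp
  have eq: "(\<lambda>t. h (s t)) = (\<lambda>t. \<Sum>c\<in>range s. h c * indicator (s -` {c}) t)"
  proof
    fix t
    have "(\<Sum>c\<in>range s. h c * indicator (s -` {c}) t) = (\<Sum>c\<in>{s t}. h c * indicator (s -` {c}) t)"
      using fin by (intro sum.mono_neutral_right) (auto simp: indicator_def)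
    then show "h (s t) = (\<Sum>c\<in>range s. h c * indicator (s -` {c}) t)" by simp
  qed
  have int: "integrable (scalar_measure E x) (\<lambda>t. h c * indicator (s -` {c}) t)" for c
    using simple_vimage[OF s] by (simp add: integrable_indicator_iff emeasure_eq_measure)
  show "integrable (scalar_measure E x) (\<lambda>t. h (s t))"
    unfolding eq by (intro Bochner_Integration.integrable_sum int)
  show "(\<integral>t. h (s t) \<partial>scalar_measure E x) = (\<Sum>c\<in>range s. h c * inner (E (s -` {c}) x) x)"
    unfolding eq using int simple_vimage[OF s]
    by (subst Bochner_Integration.integral_sum) (auto simp: measure_scalar_measure)
qed

text \<open>Polarization for each symmetric projection. The right-hand side has the form used in
  \<open>spectral_integral\<close>, so it can be passed to the limit.\<close>

lemma inner_simple_integral: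
  assumes s: "simple_function borel (s :: real \<Rightarrow> real)"
  shows "inner (simple_integral s x) z =
    ((\<integral>t. s t \<partial>scalar_measure E (x + z)) - (\<integral>t. s t \<partial>scalar_measure E (x - z))) / 4"
proof -
  have "inner (E (s -` {c}) x) z = (inner (E (s -` {c}) (x + z)) (x + z) - inner (E (s -` {c}) (x - z)) (x - z)) / 4" for c
  proof -
    have B: "s -` {c} \<in> sets borel" by (rule simple_vimage[OF s])
    have "inner (E (s -` {c}) z) x = inner (E (s -` {c}) x) z"
      using orthogonal_projection[OF B] by (simp add: orthogonal_projection_def inner_commute[of _ x])
    then show ?thesis
      by (simp add: linear_add[OF linear[OF B]] linear_diff[OF linear[OF B]] algebra_simps)
  qed
  then show ?thesis
    by (simp add: simple_integral_def inner_sum_left sum_subtractf[symmetric] sum_divide_distrib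
        right_diff_distrib diff_divide_distrib integral_simple(1)[OF s, of _ "\<lambda>c. c"])
qed

text \<open>Different level sets are disjoint, so their projections have orthogonal ranges and the
  cross terms vanish. This isometry turns convergence in L2 into convergence of vectors.\<close>

lemma norm_simple_integral:
  assumes s: "simple_function borel (s :: real \<Rightarrow> real)"
  shows "(norm (simple_integral s x))\<^sup>2 = (\<integral>t. (s t)\<^sup>2 \<partial>scalar_measure E x)"
proof -
  have fin: "finite (range s)" using simple_functionD(1)[OF s] by simp
  have "(norm (simple_integral s x))\<^sup>2 =
     (\<Sum>c\<in>range s. \<Sum>d\<in>range s. c * (d * inner (E (s -` {d}) x) (E (s -` {c}) x)))"
    unfolding power2_norm_eq_inner simple_integral_def
    by (simp add: inner_sum_left inner_sum_right sum_distrib_left)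
  also have "\<dots> = (\<Sum>c\<in>range s. \<Sum>d\<in>range s. if c = d then c\<^sup>2 * inner (E (s -` {c}) x) x else 0)"
  proof (intro sum.cong refl)
    fix c d
    have "s -` {d} \<inter> s -` {c} = (if c = d then s -` {c} else {})" by auto
    then show "c * (d * inner (E (s -` {d}) x) (E (s -` {c}) x)) =
       (if c = d then c\<^sup>2 * inner (E (s -` {c}) x) x else 0)"
      using simple_vimage[OF s] by (auto simp: inner_eq power2_eq_square)
  qed
  also have "\<dots> = (\<Sum>c\<in>range s. c\<^sup>2 * inner (E (s -` {c}) x) x)"
    using fin by simp
  finally show ?thesis by (simp add: integral_simple(1)[OF s, of _ "\<lambda>c. c\<^sup>2"])
qed

text \<open>Comparing the sums directly would require a common refinement of the level sets. Pairing
  with an arbitrary vector reduces the claim to linearity of the scalar integrals.\<close>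

lemma simple_integral_diff:
  assumes s: "simple_function borel (s :: real \<Rightarrow> real)" and s': "simple_function borel s'"
  shows "simple_integral s x - simple_integral s' x = simple_integral (\<lambda>t. s t - s' t) x"
    (is "?a = ?b")
proof -
  have d: "simple_function borel (\<lambda>t. s t - s' t)" using s s' by (rule simple_function_diff)
  have "inner (simple_integral s x - simple_integral s' x) z = inner (simple_integral (\<lambda>t. s t - s' t) x) z" for z
    using integral_simple(2)[OF s, of _ "\<lambda>c. c"] integral_simple(2)[OF s', of _ "\<lambda>c. c"]
    by (simp add: inner_diff_left inner_simple_integral[OF s] inner_simple_integral[OF s'] inner_simple_integral[OF d] field_simps)
  then have "inner (?a - ?b) (?a - ?b) = 0" by (simp add: inner_diff_left)
  then show ?thesis by simp
qed

text \<open>Truncating x to the set where |\<phi>| is at most n gives vectors of the domain that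
  converge to x. Density is what makes the vector chosen by THE in \<open>spectral_integral\<close>
  unique.\<close>

lemma domain_dense:
  assumes [measurable]: "\<phi> \<in> borel_measurable borel"
  shows "closure (domain \<phi>) = UNIV"
proof -
  have "x \<in> closure (domain \<phi>)" for x
  proof -
    interpret finite_measure "scalar_measure E x" by (rule finite_scalar_measure)
    define A where "A n = {t. \<bar>\<phi> t\<bar> \<le> real n}" for n
    have A[measurable]: "A n \<in> sets borel" for n unfolding A_def by measurable
    have mem: "E (A n) x \<in> domain \<phi>" for n
    proof -
      \<comment> \<open>The projection of the complement of \<open>A n\<close> annihilates
        \<open>E (A n) x\<close>, so the measure of this vector lives where \<phi> is bounded by
        n.\<close>
      have "AE t in scalar_measure E (E (A n) x). t \<in> A n"
      proof (rule AE_I')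
        show "- A n \<in> null_sets (scalar_measure E (E (A n) x))"
          using A by (auto simp: null_sets_def emeasure_scalar_measure compose)
      qed auto
      then have "AE t in scalar_measure E (E (A n) x). ennreal ((\<phi> t)\<^sup>2) \<le> ennreal ((real n)\<^sup>2)"
        by eventually_elim (auto simp: A_def intro!: ennreal_leI power2_le_iff_abs_le[THEN iffD2])
      then have "(\<integral>\<^sup>+t. ennreal ((\<phi> t)\<^sup>2) \<partial>scalar_measure E (E (A n) x))
          \<le> (\<integral>\<^sup>+t. ennreal ((real n)\<^sup>2) \<partial>scalar_measure E (E (A n) x))"
        by (rule nn_integral_mono_AE)
      also have "\<dots> < \<infinity>"
        by (simp add: emeasure_scalar_measure ennreal_mult_less_top)
      finally show ?thesis by (simp add: domain_def)
    qed
    have "(\<lambda>n. measure (scalar_measure E x) (- A n)) \<longlonglongrightarrow> measure (scalar_measure E x) (\<Inter>n. - A n)"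
    proof (rule finite_Lim_measure_decseq)
      show "decseq (\<lambda>n. - A n)" by (auto simp: decseq_def A_def)
    qed auto
    moreover have "(\<Inter>n. - A n) = {}"
      by (auto simp: A_def) (meson real_arch_simple)
    moreover have "measure (scalar_measure E x) (- A n) = (norm (E (A n) x - x))\<^sup>2" for n
    proof -
      have "E (A n) x + E (- A n) x = x"
        using union[of "A n" "- A n" x] by (simp add: Compl_partition)
      then have "E (A n) x - x = - E (- A n) x" by (simp add: algebra_simps eq_neg_iff_add_eq_0)
      then show ?thesis by (simp add: measure_scalar_measure inner_self)
    qed
    ultimately have "(\<lambda>n. (norm (E (A n) x - x))\<^sup>2) \<longlonglongrightarrow> 0" by simp
    then have "(\<lambda>n. sqrt ((norm (E (A n) x - x))\<^sup>2)) \<longlonglongrightarrow> sqrt 0" by (rule tendsto_real_sqrt)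
    then have "(\<lambda>n. E (A n) x) \<longlonglongrightarrow> x"
      using Lim_null tendsto_norm_zero_iff by fastforce
    with mem show ?thesis
      unfolding closure_sequential by (intro exI[of _ "\<lambda>n. E (A n) x"]) simp
  qed
  then show ?thesis by blast
qed

lemma spectral_integral_exists:
  fixes \<phi> :: "real \<Rightarrow> real"
  assumes [measurable]: "\<phi> \<in> borel_measurable borel" and x: "x \<in> domain \<phi>"
    and complete: "complete (UNIV :: 'a set)"
  obtains y where "(norm y)\<^sup>2 = (\<integral>t. (\<phi> t)\<^sup>2 \<partial>scalar_measure E x)"
    and "\<And>z. z \<in> domain \<phi> \<Longrightarrow> inner y z =
      ((\<integral>t. \<phi> t \<partial>scalar_measure E (x + z)) - (\<integral>t. \<phi> t \<partial>scalar_measure E (x - z))) / 4"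
proof -
  \<comment> \<open>Approximation with base point 0: the distance of \<open>s n t\<close> to 0 is at
    most twice that of \<open>\<phi> t\<close>. This supplies the dominating functions
    below.\<close>
  obtain s where s: "\<And>n::nat. simple_function borel (s n)"
    and lim: "\<And>t. (\<lambda>n. s n t) \<longlonglongrightarrow> \<phi> t" and bound: "\<And>n t. \<bar>s n t\<bar> \<le> 2 * \<bar>\<phi> t\<bar>"
    using borel_measurable_implies_sequence_metric[OF assms(1), of 0] by (auto simp: dist_real_def)
  note [measurable] = borel_measurable_simple_function[OF s]
  let ?I = "\<lambda>n. simple_integral (s n) x"
  have bound2: "(s n t)\<^sup>2 \<le> 4 * (\<phi> t)\<^sup>2" for n t
    using power_mono[OF bound[of n t], of 2] by (simp add: power_mult_distrib)
  note dom = integrable_square[OF assms(1) x]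
  have L2: "(\<lambda>n. \<integral>t. (s n t - \<phi> t)\<^sup>2 \<partial>scalar_measure E x) \<longlonglongrightarrow> (\<integral>t. 0 \<partial>scalar_measure E x)"
  proof (rule integral_dominated_convergence)
    \<comment> \<open>The constant is 2 * 4 + 2: the square of a difference is at most twice the sum
      of the squares, and \<open>bound2\<close> contributes the 4.\<close>
    show "integrable (scalar_measure E x) (\<lambda>t. 10 * (\<phi> t)\<^sup>2)" using dom by simp
    show "AE t in scalar_measure E x. (\<lambda>n. (s n t - \<phi> t)\<^sup>2) \<longlonglongrightarrow> 0"
    proof (rule AE_I2)
      fix t show "(\<lambda>n. (s n t - \<phi> t)\<^sup>2) \<longlonglongrightarrow> 0"
        using tendsto_power[OF tendsto_diff[OF lim[of t] tendsto_const[of "\<phi> t"]], of 2] by simp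
    qed
    show "AE t in scalar_measure E x. norm ((s n t - \<phi> t)\<^sup>2) \<le> 10 * (\<phi> t)\<^sup>2" for n
    proof (rule AE_I2)
      fix t
      have "(s n t - \<phi> t)\<^sup>2 \<le> 2 * (s n t)\<^sup>2 + 2 * (\<phi> t)\<^sup>2"
        using zero_le_power2[of "s n t + \<phi> t"] by (simp add: power2_eq_square algebra_simps)
      with bound2[of n t] show "norm ((s n t - \<phi> t)\<^sup>2) \<le> 10 * (\<phi> t)\<^sup>2" by simp
    qed
  qed measurable
  have int_diff: "integrable (scalar_measure E x) (\<lambda>t. (s n t - \<phi> t)\<^sup>2)" for n
  proof (rule Bochner_Integration.integrable_bound)
    show "integrable (scalar_measure E x) (\<lambda>t. 10 * (\<phi> t)\<^sup>2)" using dom by simp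
    show "AE t in scalar_measure E x. norm ((s n t - \<phi> t)\<^sup>2) \<le> norm (10 * (\<phi> t)\<^sup>2)"
    proof (rule AE_I2)
      fix t
      have "(s n t - \<phi> t)\<^sup>2 \<le> 2 * (s n t)\<^sup>2 + 2 * (\<phi> t)\<^sup>2"
        using zero_le_power2[of "s n t + \<phi> t"] by (simp add: power2_eq_square algebra_simps)
      with bound2[of n t] show "norm ((s n t - \<phi> t)\<^sup>2) \<le> norm (10 * (\<phi> t)\<^sup>2)" by simp
    qed
  qed measurable
  have "Cauchy ?I"
  proof (rule CauchyI)
    fix e :: real assume e: "0 < e"
    then have "\<forall>\<^sub>F n in sequentially. (\<integral>t. (s n t - \<phi> t)\<^sup>2 \<partial>scalar_measure E x) < e\<^sup>2 / 4"
      using order_tendstoD(2)[OF L2, of "e\<^sup>2 / 4"] by simp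
    then obtain N where N: "\<And>n. n \<ge> N \<Longrightarrow> (\<integral>t. (s n t - \<phi> t)\<^sup>2 \<partial>scalar_measure E x) < e\<^sup>2 / 4"
      by (auto simp: eventually_sequentially)
    have "norm (?I m - ?I n) < e" if "m \<ge> N" "n \<ge> N" for m n
    proof -
      have "(norm (?I m - ?I n))\<^sup>2 = (\<integral>t. (s m t - s n t)\<^sup>2 \<partial>scalar_measure E x)"
        by (simp add: simple_integral_diff[OF s s] norm_simple_integral[OF simple_function_diff[OF s s]])
      also have "\<dots> \<le> (\<integral>t. 2 * (s m t - \<phi> t)\<^sup>2 + 2 * (s n t - \<phi> t)\<^sup>2 \<partial>scalar_measure E x)"
      proof (rule integral_mono')
        show "integrable (scalar_measure E x) (\<lambda>t. 2 * (s m t - \<phi> t)\<^sup>2 + 2 * (s n t - \<phi> t)\<^sup>2)"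
          using int_diff by simp
        fix t
        show "(s m t - s n t)\<^sup>2 \<le> 2 * (s m t - \<phi> t)\<^sup>2 + 2 * (s n t - \<phi> t)\<^sup>2"
          using zero_le_power2[of "(s m t - \<phi> t) + (s n t - \<phi> t)"] by (simp add: power2_eq_square algebra_simps)
      qed simp
      also have "\<dots> = 2 * (\<integral>t. (s m t - \<phi> t)\<^sup>2 \<partial>scalar_measure E x) + 2 * (\<integral>t. (s n t - \<phi> t)\<^sup>2 \<partial>scalar_measure E x)"
        using int_diff by simp
      also have "\<dots> < e\<^sup>2" using N[OF that(1)] N[OF that(2)] by simp
      finally show ?thesis using e by (simp add: power_less_imp_less_base)
    qed
    then show "\<exists>N. \<forall>m\<ge>N. \<forall>n\<ge>N. norm (?I m - ?I n) < e" by blast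
  qed
  then obtain y where y: "?I \<longlonglongrightarrow> y"
    using complete unfolding complete_def by blast
  have "(\<lambda>n. \<integral>t. (s n t)\<^sup>2 \<partial>scalar_measure E x) \<longlonglongrightarrow> (\<integral>t. (\<phi> t)\<^sup>2 \<partial>scalar_measure E x)"
  proof (rule integral_dominated_convergence)
    show "integrable (scalar_measure E x) (\<lambda>t. 4 * (\<phi> t)\<^sup>2)" using dom by simp
  qed (use bound2 lim in \<open>auto intro!: AE_I2 tendsto_power\<close>)
  moreover have "(\<lambda>n. \<integral>t. (s n t)\<^sup>2 \<partial>scalar_measure E x) \<longlonglongrightarrow> (norm y)\<^sup>2"
    using tendsto_power[OF tendsto_norm[OF y], of 2] by (simp add: norm_simple_integral[OF s])
  ultimately have 1: "(norm y)\<^sup>2 = (\<integral>t. (\<phi> t)\<^sup>2 \<partial>scalar_measure E x)"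
    by (rule LIMSEQ_unique[rotated])
  have 2: "inner y z =
      ((\<integral>t. \<phi> t \<partial>scalar_measure E (x + z)) - (\<integral>t. \<phi> t \<partial>scalar_measure E (x - z))) / 4"
    if z: "z \<in> domain \<phi>" for z
  proof -
    have *: "(\<lambda>n. \<integral>t. s n t \<partial>scalar_measure E w) \<longlonglongrightarrow> (\<integral>t. \<phi> t \<partial>scalar_measure E w)"
      if w: "w \<in> domain \<phi>" for w
    proof (rule integral_dominated_convergence)
      show "integrable (scalar_measure E w) (\<lambda>t. 2 * \<bar>\<phi> t\<bar>)" using integrable[OF assms(1) w] by simp
    qed (use bound lim in \<open>auto intro!: AE_I2\<close>)
    have "(\<lambda>n. inner (?I n) z) \<longlonglongrightarrow>
      ((\<integral>t. \<phi> t \<partial>scalar_measure E (x + z)) - (\<integral>t. \<phi> t \<partial>scalar_measure E (x - z))) / 4"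
      unfolding inner_simple_integral[OF s]
      by (intro tendsto_intros * domain_add domain_diff assms z) simp
    moreover have "(\<lambda>n. inner (?I n) z) \<longlonglongrightarrow> inner y z"
      by (intro tendsto_intros y)
    ultimately show ?thesis by (rule LIMSEQ_unique[rotated])
  qed
  from 1 2 show thesis by (rule that)
qed

lemma dom_spectral_integral: "dom (spectral_integral E \<phi>) = domain \<phi>"
  by (auto simp: spectral_integral_def domain_def Let_def dom_def)

text \<open>The approximating construction produces a vector with the right norm and the right
  pairings; density of the domain identifies it with the one in the definition.\<close>

theorem norm_spectral_integral:
  fixes \<phi> :: "real \<Rightarrow> real"
  assumes [measurable]: "\<phi> \<in> borel_measurable borel" and x: "x \<in> domain \<phi>"
    and complete: "complete (UNIV :: 'a set)"
  shows "ennreal ((norm (app (spectral_integral E \<phi>) x))\<^sup>2) = (\<integral>\<^sup>+t. ennreal ((\<phi> t)\<^sup>2) \<partial>scalar_measure E x)"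
proof -
  let ?b = "\<lambda>z. ((\<integral>t. \<phi> t \<partial>scalar_measure E (x + z)) - (\<integral>t. \<phi> t \<partial>scalar_measure E (x - z))) / 4"
  obtain y where norm: "(norm y)\<^sup>2 = (\<integral>t. (\<phi> t)\<^sup>2 \<partial>scalar_measure E x)"
    and y: "\<And>z. z \<in> domain \<phi> \<Longrightarrow> inner y z = ?b z"
    using spectral_integral_exists[OF assms] by metis
  have "(THE y. \<forall>z\<in>domain \<phi>. inner y z = ?b z) = y"
  proof (rule the_equality)
    fix y' assume y': "\<forall>z\<in>domain \<phi>. inner y' z = ?b z"
    have "closed {z. inner (y' - y) z = 0}"
      by (intro closed_Collect_eq continuous_intros)
    moreover have "domain \<phi> \<subseteq> {z. inner (y' - y) z = 0}"
      by (auto simp: inner_diff_left y bspec[OF y'] simp del: eq_divide_eq_numeral1)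
    ultimately have "closure (domain \<phi>) \<subseteq> {z. inner (y' - y) z = 0}"
      by (rule closure_minimal[rotated])
    then have "inner (y' - y) (y' - y) = 0" unfolding domain_dense[OF assms(1)] by blast
    then show "y' = y" by simp
  qed (use y in blast)
  then have "app (spectral_integral E \<phi>) x = y"
    using x by (simp add: spectral_integral_def Let_def domain_def)
  then show ?thesis
    using norm nn_integral_eq_integral[OF integrable_square[OF assms(1) x]] by simp
qed
end

section \<open>Images of projection-valued measures under Borel maps\<close>

lemma pvm_vimage:
  assumes "pvm E" and [measurable]: "\<psi> \<in> borel_measurable borel"
  shows "pvm (\<lambda>B. E (\<psi> -` B))"
proof -
  interpret pvm E by fact
  have m: "\<psi> -` B \<in> sets borel" if "B \<in> sets borel" for B
    using measurable_sets[OF assms(2) that] by simp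
  have "(\<lambda>n. E (\<psi> -` B n) x) sums E (\<psi> -` (\<Union>n. B n)) x"
    if "range B \<subseteq> sets borel" "disjoint_family B" for B :: "nat \<Rightarrow> real set" and x
    unfolding vimage_UN using that m by (intro sums) (auto simp: disjoint_family_on_def)
  then show ?thesis
    by (auto simp: pvm_def projection_valued_measure_def fun_eq_iff compose m orthogonal_projection)
qed

lemma scalar_measure_vimage:
  assumes "pvm E" and [measurable]: "\<psi> \<in> borel_measurable borel"
  shows "scalar_measure (\<lambda>B. E (\<psi> -` B)) x = distr (scalar_measure E x) borel \<psi>"
proof -
  interpret E: pvm E by fact
  interpret F: pvm "\<lambda>B. E (\<psi> -` B)" by (rule pvm_vimage[OF assms])
  show ?thesis
  proof (rule measure_eqI)
    fix B assume "B \<in> sets (scalar_measure (\<lambda>B. E (\<psi> -` B)) x)"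
    then have [measurable]: "B \<in> sets borel" by simp
    have "\<psi> -` B \<in> sets borel" using measurable_sets[OF assms(2), of B] by simp
    then show "emeasure (scalar_measure (\<lambda>B. E (\<psi> -` B)) x) B = emeasure (distr (scalar_measure E x) borel \<psi>) B"
      by (simp add: emeasure_distr F.emeasure_scalar_measure E.emeasure_scalar_measure)
  qed simp
qed

text \<open>Change of variables in both the domain condition and the polarized integrals. With
  \<psi> the square root it yields \<open>D\<close> from the identity and the power r/2 of
  \<open>\<Delta>\<close> from the power r.\<close>

lemma spectral_integral_vimage:
  assumes "pvm E" and [measurable]: "\<psi> \<in> borel_measurable borel" "\<phi> \<in> borel_measurable borel"
  shows "spectral_integral (\<lambda>B. E (\<psi> -` B)) \<phi> = spectral_integral E (\<lambda>t. \<phi> (\<psi> t))"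
proof -
  interpret E: pvm E by fact
  have "(\<integral>t. \<phi> t \<partial>distr (scalar_measure E x) borel \<psi>) = (\<integral>t. \<phi> (\<psi> t) \<partial>scalar_measure E x)" for x
    by (rule integral_distr) measurable
  then show ?thesis
    unfolding spectral_integral_def scalar_measure_vimage[OF assms(1,2)]
    by (simp add: nn_integral_distr cong: if_cong)
qed

section \<open>Dyadic pieces and the K-functional\<close>

lemma dyadic_interval:
  fixes t :: real
  assumes "1 < t" "t \<le> 2 ^ j"
  obtains i where "i < j" "2 ^ i < t" "t \<le> 2 ^ (i + 1)"
  using assms(2)
proof (induction j arbitrary: thesis)
  case 0
  then show ?case using assms(1) by simp
next
  case (Suc j)
  show ?case
  proof (cases "t \<le> 2 ^ j")
    case True
    then show ?thesis using Suc.IH Suc.prems(1) less_SucI by metis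
  next
    case False
    then show ?thesis using Suc.prems by (intro Suc.prems(1)[of j]) auto
  qed
qed

locale nonneg_pvm = pvm F for F :: "real set \<Rightarrow> 'a::{real_inner,complete_space} \<Rightarrow> 'a" +
  assumes nonneg: "F {0..} = id"
begin

definition low :: "'a \<Rightarrow> 'a" where "low f = F {0..1} f"

text \<open>Open on the left and closed on the right: together with the closed interval of
  \<open>low\<close>, the bands partition the half-line.\<close>

definition band :: "'a \<Rightarrow> nat \<Rightarrow> 'a" where "band f j = F {2 ^ j<..2 ^ (j + 1)} f"

text \<open>With \<open>F\<close> the spectral measure of \<open>D\<close>, this is \<open>D\<close>
  to the power r, hence \<open>\<Delta>\<close> to the power r/2.\<close>

definition power_op :: "nat \<Rightarrow> 'a operator" where "power_op r = spectral_integral F (\<lambda>t. t powr real r)"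

lemma norm_power:
  assumes "x \<in> dom (power_op r)"
  shows "ennreal ((norm (app (power_op r) x))\<^sup>2) = (\<integral>\<^sup>+t. ennreal ((t powr real r)\<^sup>2) \<partial>scalar_measure F x)"
  unfolding power_op_def
  by (rule norm_spectral_integral)
    (use assms in \<open>auto simp: power_op_def dom_spectral_integral complete_UNIV\<close>)

text \<open>Zero is the test vector that makes the infimum range over a nonempty set and gives the
  trivial bound of K by the norm of f. Its image vanishes by the norm formula, as its scalar measure
  is zero.\<close>

lemma zero_in_dom: "0 \<in> dom (power_op r)" and norm_power_zero: "norm (app (power_op r) 0) = 0"
proof -
  have "(\<integral>\<^sup>+t. ennreal ((t powr real r)\<^sup>2) \<partial>scalar_measure F 0) = 0"
    by (subst nn_integral_0_iff_AE, simp, rule AE_I'[of UNIV])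
       (auto simp: null_sets_def emeasure_scalar_measure)
  then show "0 \<in> dom (power_op r)" by (simp add: power_op_def dom_spectral_integral domain_def)
  from norm_power[OF this] \<open>_ = 0\<close> show "norm (app (power_op r) 0) = 0" by simp
qed

lemma K_bdd_below: "0 \<le> t \<Longrightarrow> bdd_below ((\<lambda>g. norm (f - g) + t * (norm g + norm (app (power_op r) g))) ` dom (power_op r))"
  by (rule bdd_belowI2[of _ 0]) simp

lemma K_le: "0 \<le> t \<Longrightarrow> g \<in> dom (power_op r) \<Longrightarrow>
    K_functional (power_op r) t f \<le> norm (f - g) + t * (norm g + norm (app (power_op r) g))"
  unfolding K_functional_def by (rule cINF_lower[OF K_bdd_below])

lemma le_K: "(\<And>g. g \<in> dom (power_op r) \<Longrightarrow> c \<le> norm (f - g) + t * (norm g + norm (app (power_op r) g))) \<Longrightarrow>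
    c \<le> K_functional (power_op r) t f"
  unfolding K_functional_def by (rule cINF_greatest) (use zero_in_dom in blast)

lemma K_nonneg: "0 \<le> t \<Longrightarrow> 0 \<le> K_functional (power_op r) t f"
  by (rule le_K) simp

lemma K_le_norm: "0 \<le> t \<Longrightarrow> K_functional (power_op r) t f \<le> norm f"
  using K_le[OF _ zero_in_dom, of t r f] by (simp add: norm_power_zero)

lemma K_mono: "0 \<le> s \<Longrightarrow> s \<le> t \<Longrightarrow> K_functional (power_op r) s f \<le> K_functional (power_op r) t f"
  by (rule le_K, rule order_trans, rule K_le) (auto intro!: mult_right_mono)

lemma norm_low_le: "norm (low f) \<le> norm f"
  by (simp add: low_def norm_le)

text \<open>For any competitor h, split the band of f into those of f - h and h. The projection
  contracts the first; a Chebyshev bound controls the second, since the multiplier is at least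
  2^(jr) on the band.\<close>

lemma norm_band_le_K: "norm (band f j) \<le> K_functional (power_op r) (2 powr (- (real j * real r))) f"
proof (rule le_K)
  fix h assume h: "h \<in> dom (power_op r)"
  let ?B = "{2 ^ j<..2 ^ (j + 1)} :: real set"
  have "ennreal ((2 powr (real j * real r))\<^sup>2 * (norm (band h j))\<^sup>2) =
      (\<integral>\<^sup>+t. ennreal ((2 powr (real j * real r))\<^sup>2) * indicator ?B t \<partial>scalar_measure F h)"
    by (simp add: nn_integral_cmult_indicator emeasure_scalar_measure inner_self band_def ennreal_mult)
  also have "\<dots> \<le> (\<integral>\<^sup>+t. ennreal ((t powr real r)\<^sup>2) \<partial>scalar_measure F h)"
  proof (rule nn_integral_mono)
    fix t :: real
    have "2 powr (real j * real r) \<le> t powr real r" if "2 ^ j < t"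
    proof -
      have "2 powr (real j * real r) = (2 ^ j) powr real r" by (simp add: powr_powr flip: powr_realpow)
      also have "\<dots> \<le> t powr real r" using that by (intro powr_mono2) auto
      finally show ?thesis .
    qed
    then show "ennreal ((2 powr (real j * real r))\<^sup>2) * indicator ?B t \<le> ennreal ((t powr real r)\<^sup>2)"
      by (auto simp: indicator_def intro!: ennreal_leI power_mono)
  qed
  also have "\<dots> = ennreal ((norm (app (power_op r) h))\<^sup>2)" by (rule norm_power[OF h, symmetric])
  finally have "(2 powr (real j * real r) * norm (band h j))\<^sup>2 \<le> (norm (app (power_op r) h))\<^sup>2"
    by (simp add: power_mult_distrib)
  then have "2 powr (real j * real r) * norm (band h j) \<le> norm (app (power_op r) h)"
    by (simp add: power2_le_iff_abs_le)
  then have 1: "norm (band h j) \<le> 2 powr (- (real j * real r)) * norm (app (power_op r) h)"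
    by (simp add: powr_minus field_simps)
  have "norm (band f j) = norm (band (f - h) j + band h j)"
    by (simp add: band_def linear_diff[OF linear])
  also have "\<dots> \<le> norm (band (f - h) j) + norm (band h j)" by (rule norm_triangle_ineq)
  also have "norm (band (f - h) j) \<le> norm (f - h)" by (simp add: band_def norm_le)
  finally show "norm (band f j) \<le> norm (f - h) + 2 powr (- (real j * real r)) * (norm h + norm (app (power_op r) h))"
    using 1 mult_nonneg_nonneg[OF powr_ge_zero norm_ge_zero, of 2 "- (real j * real r)" h]
    unfolding distrib_left by linarith
qed

lemma diff_low_pass: "f - F {0..2 ^ j} f = F {2 ^ j<..} f"
proof -
  have "{0..} = {0..2 ^ j} \<union> ({2 ^ j<..} :: real set)" by (auto intro: order_trans less_imp_le) (smt (verit) zero_le_power)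
  then have "f = F {0..2 ^ j} f + F {2 ^ j<..} f"
    using fun_cong[OF nonneg, of f] union[of "{0..2 ^ j}" "{2 ^ j<..}" f]
    by (simp add: ivl_disj_int)
  then show ?thesis by (simp add: algebra_simps)
qed

text \<open>Parseval for the part of f above 2^j: countable additivity over the bands is paired with
  f, and each pairing is a squared norm.\<close>

lemma sums_band: "(\<lambda>i. (norm (band f (i + j)))\<^sup>2) sums (norm (f - F {0..2 ^ j} f))\<^sup>2"
proof -
  let ?B = "\<lambda>i. {2 ^ (i + j)<..2 ^ (i + j + 1)} :: real set"
  have U: "(\<Union>i. ?B i) = {2 ^ j<..}"
  proof (intro equalityI subsetI)
    fix t :: real assume t: "t \<in> {2 ^ j<..}"
    obtain n where "t / 2 ^ j < 2 ^ n" using real_arch_pow[of 2] by auto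
    with t obtain i where "2 ^ i < t / 2 ^ j" "t / 2 ^ j \<le> 2 ^ (i + 1)"
      using dyadic_interval[of "t / 2 ^ j" n] by (auto simp: field_simps)
    then show "t \<in> (\<Union>i. ?B i)" by (auto simp: field_simps power_add)
  next
    fix t :: real assume "t \<in> (\<Union>i. ?B i)"
    then obtain i where "2 ^ (i + j) < t" by auto
    moreover have "(2::real) ^ j \<le> 2 ^ (i + j)" by (rule power_increasing) auto
    ultimately show "t \<in> {2 ^ j<..}" unfolding greaterThan_iff by (rule le_less_trans[rotated])
  qed
  have "disjoint_family ?B"
  proof -
    have "?B m \<inter> ?B n = {}" if "m < n" for m n
    proof -
      have "(2::real) ^ (m + j + 1) \<le> 2 ^ (n + j)" using that by (intro power_increasing) auto
      then show ?thesis by auto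
    qed
    then show ?thesis unfolding disjoint_family_on_def by (metis Int_commute linorder_neqE_nat)
  qed
  then have "(\<lambda>i. F (?B i) f) sums F (\<Union>i. ?B i) f"
    by (intro sums) auto
  then have "(\<lambda>i. F (?B i) f) sums F {2 ^ j<..} f"
    by (simp only: U)
  then have "(\<lambda>i. inner (F (?B i) f) f) sums inner (F {2 ^ j<..} f) f"
    by (rule bounded_linear.sums[OF bounded_linear_inner_left])
  then show ?thesis by (simp add: diff_low_pass inner_self band_def)
qed

lemma norm_diff_low_pass: "norm (f - F {0..2 ^ j} f) = sqrt (\<Sum>i. (norm (band f (i + j)))\<^sup>2)"
  by (simp flip: sums_unique[OF sums_band])

text \<open>The measure of the low-pass vector lives on [0, 2^j], where a step function constant on
  [0, 1] and on each band dominates \<psi>. It is used with \<psi> the squared multiplier and with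
  \<psi> = 1.\<close>

lemma nn_integral_low_pass_le:
  fixes \<psi> :: "real \<Rightarrow> real" and c :: "nat \<Rightarrow> real"
  assumes "\<And>t. 0 \<le> t \<Longrightarrow> t \<le> 1 \<Longrightarrow> \<psi> t \<le> 1"
    and "\<And>i t. 2 ^ i < t \<Longrightarrow> t \<le> 2 ^ (i + 1) \<Longrightarrow> \<psi> t \<le> c i" and c: "\<And>i. 0 \<le> c i"
  shows "(\<integral>\<^sup>+t. ennreal (\<psi> t) \<partial>scalar_measure F (F {0..2 ^ j} f))
    \<le> ennreal ((norm (low f))\<^sup>2 + (\<Sum>i<j. c i * (norm (band f i))\<^sup>2))"
proof -
  let ?P = "{0..2 ^ j} :: real set" and ?B = "\<lambda>i::nat. {2 ^ i<..2 ^ (i + 1)} :: real set"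
  let ?\<mu> = "scalar_measure F (F ?P f)"
  have "AE t in ?\<mu>. t \<in> ?P"
  proof (rule AE_I')
    show "- ?P \<in> null_sets ?\<mu>"
      by (auto simp: null_sets_def emeasure_scalar_measure compose)
  qed auto
  then have "AE t in ?\<mu>. ennreal (\<psi> t) \<le> indicator {0..1} t + (\<Sum>i<j. ennreal (c i) * indicator (?B i) t)"
  proof eventually_elim
    case (elim t)
    show ?case
    proof (cases "t \<le> 1")
      case True
      then have "ennreal (\<psi> t) \<le> indicator {0..1} t"
        using assms(1)[of t] elim by (simp add: indicator_def ennreal_le_1)
      then show ?thesis by (rule order_trans) simp
    next
      case False
      then obtain i where i: "i < j" "2 ^ i < t" "t \<le> 2 ^ (i + 1)"
        using dyadic_interval[of t j] elim by auto
      then have "ennreal (\<psi> t) \<le> ennreal (c i) * indicator (?B i) t"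
        using assms(2)[of i t] by (simp add: ennreal_leI)
      also have "\<dots> \<le> (\<Sum>i<j. ennreal (c i) * indicator (?B i) t)"
        using i(1) by (intro member_le_sum) auto
      finally show ?thesis by (simp add: add_increasing)
    qed
  qed
  then have "(\<integral>\<^sup>+t. ennreal (\<psi> t) \<partial>?\<mu>) \<le>
      (\<integral>\<^sup>+t. indicator {0..1} t + (\<Sum>i<j. ennreal (c i) * indicator (?B i) t) \<partial>?\<mu>)"
    by (rule nn_integral_mono_AE)
  also have "\<dots> = emeasure ?\<mu> {0..1} + (\<Sum>i<j. ennreal (c i) * emeasure ?\<mu> (?B i))"
  proof -
    have "(\<integral>\<^sup>+t. (\<Sum>i<j. ennreal (c i) * indicator (?B i) t) \<partial>?\<mu>) =
        (\<Sum>i<j. \<integral>\<^sup>+t. ennreal (c i) * indicator (?B i) t \<partial>?\<mu>)"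
      by (rule nn_integral_sum) measurable
    also have "\<dots> = (\<Sum>i<j. ennreal (c i) * emeasure ?\<mu> (?B i))"
      by (intro sum.cong refl nn_integral_cmult_indicator) simp
    moreover have "(\<integral>\<^sup>+t. indicator {0..1} t + (\<Sum>i<j. ennreal (c i) * indicator (?B i) t) \<partial>?\<mu>) =
        (\<integral>\<^sup>+t. indicator {0..1} t \<partial>?\<mu>) + (\<integral>\<^sup>+t. (\<Sum>i<j. ennreal (c i) * indicator (?B i) t) \<partial>?\<mu>)"
      by (rule nn_integral_add) measurable
    ultimately show ?thesis by simp
  qed
  also have "\<dots> \<le> ennreal ((norm (low f))\<^sup>2) + (\<Sum>i<j. ennreal (c i) * ennreal ((norm (band f i))\<^sup>2))"
  proof (intro add_mono sum_mono mult_left_mono)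
    have *: "emeasure ?\<mu> B \<le> ennreal ((norm (F B f))\<^sup>2)" if "B \<in> sets borel" for B
    proof -
      have "F B (F ?P f) = F ?P (F B f)" using that by (simp add: compose Int_commute)
      then have "norm (F B (F ?P f)) \<le> norm (F B f)" using norm_le[of ?P "F B f"] by simp
      then show ?thesis using that by (simp add: emeasure_scalar_measure inner_self ennreal_leI power_mono)
    qed
    show "emeasure ?\<mu> {0..1} \<le> ennreal ((norm (low f))\<^sup>2)" unfolding low_def by (rule *) simp
    show "emeasure ?\<mu> (?B i) \<le> ennreal ((norm (band f i))\<^sup>2)" for i unfolding band_def by (rule *) simp
  qed simp
  also have "\<dots> = ennreal ((norm (low f))\<^sup>2 + (\<Sum>i<j. c i * (norm (band f i))\<^sup>2))"
    using c by (subst ennreal_plus) (auto simp: ennreal_mult intro!: sum_nonneg simp flip: sum_ennreal)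
  finally show ?thesis .
qed

text \<open>The exponent i + 1 comes from the upper end of the i-th band. These weights are at least
  1, so the same right-hand side bounds the vector itself and both terms of the graph norm can share
  it.\<close>

lemma low_pass_in_dom: "F {0..2 ^ j} f \<in> dom (power_op r)"
  and norm_power_low_pass: "(norm (app (power_op r) (F {0..2 ^ j} f)))\<^sup>2
    \<le> (norm (low f))\<^sup>2 + (\<Sum>i<j. (2 powr ((real i + 1) * real r) * norm (band f i))\<^sup>2)" (is "_ \<le> ?R")
  and norm_low_pass: "(norm (F {0..2 ^ j} f))\<^sup>2
    \<le> (norm (low f))\<^sup>2 + (\<Sum>i<j. (2 powr ((real i + 1) * real r) * norm (band f i))\<^sup>2)"
proof -
  let ?h = "F {0..2 ^ j} f"
  have R: "?R = (norm (low f))\<^sup>2 + (\<Sum>i<j. (2 powr ((real i + 1) * real r))\<^sup>2 * (norm (band f i))\<^sup>2)"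
    by (simp add: power_mult_distrib)
  have nonneg_R: "0 \<le> ?R" by (intro add_nonneg_nonneg sum_nonneg) auto
  have 1: "(\<integral>\<^sup>+t. ennreal ((t powr real r)\<^sup>2) \<partial>scalar_measure F ?h) \<le> ennreal ?R"
    unfolding R
  proof (rule nn_integral_low_pass_le)
    show "(t powr real r)\<^sup>2 \<le> 1" if "0 \<le> t" "t \<le> 1" for t :: real
      using that by (simp add: power_le_one powr_le1)
    show "(t powr real r)\<^sup>2 \<le> (2 powr ((real i + 1) * real r))\<^sup>2" if "2 ^ i < t" "t \<le> 2 ^ (i + 1)" for i :: nat and t :: real
    proof (rule power_mono)
      have "0 < t" using that(1) zero_less_power[of "2::real" i] by linarith
      then have "t powr real r \<le> (2 ^ (i + 1)) powr real r"
        using that by (intro powr_mono2) auto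
      also have "\<dots> = (2 powr (real (i + 1))) powr real r" by (subst powr_realpow) auto
      also have "\<dots> = 2 powr ((real i + 1) * real r)" by (simp add: powr_powr add.commute)
      finally show "t powr real r \<le> 2 powr ((real i + 1) * real r)" .
    qed simp
  qed simp
  then show dom: "?h \<in> dom (power_op r)"
    by (auto simp: power_op_def dom_spectral_integral domain_def intro: le_less_trans)
  show "(norm (app (power_op r) ?h))\<^sup>2 \<le> ?R"
    using 1 unfolding norm_power[OF dom, symmetric] ennreal_le_iff[OF nonneg_R] .
  have "(\<integral>\<^sup>+t. ennreal 1 \<partial>scalar_measure F ?h) \<le> ennreal ?R"
    unfolding R
    by (rule nn_integral_low_pass_le) (auto intro!: one_le_power ge_one_powr_ge_zero)
  then show "(norm ?h)\<^sup>2 \<le> ?R"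
    using nonneg_R by (simp add: emeasure_scalar_measure ennreal_le_iff flip: power2_norm_eq_inner)
qed

lemma K_le_dyadic:
  assumes "0 \<le> t"
  shows "K_functional (power_op r) t f \<le> sqrt (\<Sum>i. (norm (band f (i + j)))\<^sup>2)
    + 2 * t * sqrt ((norm (low f))\<^sup>2 + (\<Sum>i<j. (2 powr ((real i + 1) * real r) * norm (band f i))\<^sup>2))"
proof -
  let ?h = "F {0..2 ^ j} f"
  have "norm ?h \<le> sqrt ((norm (low f))\<^sup>2 + (\<Sum>i<j. (2 powr ((real i + 1) * real r) * norm (band f i))\<^sup>2))"
    "norm (app (power_op r) ?h) \<le> sqrt ((norm (low f))\<^sup>2 + (\<Sum>i<j. (2 powr ((real i + 1) * real r) * norm (band f i))\<^sup>2))"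
    by (rule real_le_rsqrt, rule norm_low_pass norm_power_low_pass)+
  then have "t * (norm ?h + norm (app (power_op r) ?h)) \<le>
     t * (2 * sqrt ((norm (low f))\<^sup>2 + (\<Sum>i<j. (2 powr ((real i + 1) * real r) * norm (band f i))\<^sup>2)))"
    using assms by (intro mult_left_mono) auto
  then show ?thesis
    unfolding norm_diff_low_pass[symmetric] using K_le[OF assms low_pass_in_dom[of j f r], of f] by simp
qed

text \<open>The weights decay away from scale j at rate \<alpha> above it and r - \<alpha> below it.
  The allowed growth \<epsilon> uses at most half of each rate, so after squaring both sides are
  dominated by a geometric series of ratio \<rho> = 2^(-2 \<epsilon>); \<open>S\<close> absorbs the
  root of its sum. In the second claim 1 stems from the high part and 2 * 2^r from the low-pass test
  vector.\<close>

lemma K_le_of_weighted_bound: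
  assumes \<epsilon>: "0 < \<epsilon>" "2 * \<epsilon> \<le> \<alpha>" "2 * \<epsilon> \<le> real r - \<alpha>" and M: "0 \<le> M"
    and band: "\<And>i. 2 powr (real i * \<alpha>) * norm (band f i) \<le> M * 2 powr (\<epsilon> * \<bar>real i - real j\<bar>)"
    and low: "norm (low f) \<le> M * 2 powr (\<epsilon> * real j)"
  defines "S \<equiv> sqrt (2 / (1 - (2 powr (- \<epsilon>))\<^sup>2))"
  shows "norm (f - F {0..2 ^ j} f) \<le> S * M * 2 powr (- (real j * \<alpha>))"
    and "0 \<le> t \<Longrightarrow> t \<le> 2 powr (- (real j * real r)) \<Longrightarrow>
      K_functional (power_op r) t f \<le> (1 + 2 * 2 powr real r) * S * M * 2 powr (- (real j * \<alpha>))"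
proof -
  define \<rho> where "\<rho> = (2 powr (- \<epsilon>))\<^sup>2"
  have "2 powr (- \<epsilon>) < 2 powr (0::real)" using \<epsilon> by (intro powr_less_mono) auto
  then have \<rho>: "0 \<le> \<rho>" "\<rho> < 1" by (auto simp: \<rho>_def power_less_one_iff)
  have \<rho>_power: "\<rho> ^ n = (2 powr (- (\<epsilon> * real n)))\<^sup>2" for n
    by (simp add: \<rho>_def powr_powr mult_ac flip: powr_realpow power_mult power2_eq_square)
  have le: "norm (band f i) \<le> M * 2 powr (\<epsilon> * \<bar>real i - real j\<bar> - real i * \<alpha>)" for i
    using band[of i] by (simp add: powr_diff field_simps)
  have high: "(\<Sum>i. (norm (band f (i + j)))\<^sup>2) \<le> (S * M * 2 powr (- (real j * \<alpha>)))\<^sup>2"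
  proof -
    have summand: "(norm (band f (i + j)))\<^sup>2 \<le> (M * 2 powr (- (real j * \<alpha>)))\<^sup>2 * \<rho> ^ i" for i
    proof -
      have "norm (band f (i + j)) \<le> M * 2 powr (\<epsilon> * real i - (real i + real j) * \<alpha>)"
        using le[of "i + j"] by simp
      also have "\<dots> \<le> M * 2 powr (- (real j * \<alpha>) + - (\<epsilon> * real i))"
        using M mult_left_mono[OF \<epsilon>(2), of "real i"]
        by (intro mult_left_mono powr_mono) (auto simp: algebra_simps)
      finally have "(norm (band f (i + j)))\<^sup>2 \<le> (M * 2 powr (- (real j * \<alpha>) + - (\<epsilon> * real i)))\<^sup>2"
        by (rule power_mono) simp
      then show ?thesis by (simp only: powr_add \<rho>_power power_mult_distrib mult_ac)
    qed
    have "(\<Sum>i. (norm (band f (i + j)))\<^sup>2) \<le> (\<Sum>i. (M * 2 powr (- (real j * \<alpha>)))\<^sup>2 * \<rho> ^ i)"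
      using summand sums_summable[OF sums_band] \<rho> by (intro suminf_le summable_mult summable_geometric) auto
    also have "\<dots> = (M * 2 powr (- (real j * \<alpha>)))\<^sup>2 * (1 / (1 - \<rho>))"
      using \<rho> by (subst suminf_mult) (auto simp: suminf_geometric)
    also have "\<dots> \<le> (M * 2 powr (- (real j * \<alpha>)))\<^sup>2 * (2 / (1 - \<rho>))"
      using \<rho> by (intro mult_left_mono divide_right_mono) auto
    also have "\<dots> = (S * M * 2 powr (- (real j * \<alpha>)))\<^sup>2"
      using \<rho> by (simp add: S_def power_mult_distrib flip: \<rho>_def)
    finally show ?thesis .
  qed
  have S: "0 \<le> S" using \<rho> by (simp add: S_def flip: \<rho>_def)
  have high': "sqrt (\<Sum>i. (norm (band f (i + j)))\<^sup>2) \<le> S * M * 2 powr (- (real j * \<alpha>))"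
    using high S M by (intro real_le_lsqrt) auto
  then show "norm (f - F {0..2 ^ j} f) \<le> S * M * 2 powr (- (real j * \<alpha>))"
    by (simp only: norm_diff_low_pass)
  \<comment> \<open>The size allowed at scale j after weighting by the operator; the factor 2^r is
    due to the upper end of the band.\<close>
  let ?Q = "2 powr real r * M * 2 powr (real j * (real r - \<alpha>))"
  have "(norm (low f))\<^sup>2 + (\<Sum>i<j. (2 powr ((real i + 1) * real r) * norm (band f i))\<^sup>2)
      \<le> ?Q\<^sup>2 + (\<Sum>i<j. ?Q\<^sup>2 * \<rho> ^ (j - i))"
  proof (intro add_mono sum_mono)
    have "M * 2 powr (\<epsilon> * real j) \<le> M * 2 powr (real r + real j * (real r - \<alpha>))"
      using M \<epsilon> mult_right_mono[of \<epsilon> "real r - \<alpha>" "real j"]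
      by (intro mult_left_mono powr_mono) (auto simp: mult.commute)
    then show "(norm (low f))\<^sup>2 \<le> ?Q\<^sup>2"
      using low by (intro power_mono) (auto simp: powr_add mult_ac)
    fix i assume "i \<in> {..<j}"
    then have i: "i < j" by simp
    have "2 powr ((real i + 1) * real r) * norm (band f i) \<le>
        2 powr ((real i + 1) * real r) * (M * 2 powr (\<epsilon> * (real j - real i) - real i * \<alpha>))"
      using le[of i] i by (intro mult_left_mono) auto
    also have "\<dots> = M * 2 powr ((real i + 1) * real r + (\<epsilon> * (real j - real i) - real i * \<alpha>))"
      by (simp add: powr_add)
    also have "\<dots> \<le> M * 2 powr (real r + real j * (real r - \<alpha>) + - (\<epsilon> * real (j - i)))"
      using M i mult_left_mono[OF \<epsilon>(3), of "real j - real i"]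
      by (intro mult_left_mono powr_mono) (auto simp: algebra_simps of_nat_diff)
    finally have "(2 powr ((real i + 1) * real r) * norm (band f i))\<^sup>2 \<le>
        (M * 2 powr (real r + real j * (real r - \<alpha>) + - (\<epsilon> * real (j - i))))\<^sup>2"
      by (rule power_mono) simp
    then show "(2 powr ((real i + 1) * real r) * norm (band f i))\<^sup>2 \<le> ?Q\<^sup>2 * \<rho> ^ (j - i)"
      by (simp only: powr_add \<rho>_power power_mult_distrib mult_ac)
  qed
  also have "\<dots> = ?Q\<^sup>2 * (1 + (\<Sum>i<j. \<rho> ^ (j - i)))" by (simp add: distrib_left sum_distrib_left)
  also have "(\<Sum>i<j. \<rho> ^ (j - i)) = (\<Sum>i<j. \<rho> ^ Suc i)"
    by (rule sum.reindex_bij_witness[of _ "\<lambda>i. j - Suc i" "\<lambda>i. j - Suc i"]) (auto simp: Suc_diff_Suc)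
  \<comment> \<open>The low piece has supplied the term 1, which fills the missing index 0 of the
    geometric series.\<close>
  also have "1 + (\<Sum>i<j. \<rho> ^ Suc i) = (\<Sum>i<Suc j. \<rho> ^ i)" by (simp only: sum.lessThan_Suc_shift) simp
  also have "\<dots> \<le> (\<Sum>i. \<rho> ^ i)"
    using \<rho> by (intro sum_le_suminf summable_geometric) auto
  also have "\<dots> \<le> 2 / (1 - \<rho>)"
    using \<rho> by (simp add: suminf_geometric divide_right_mono)
  also have "?Q\<^sup>2 * (2 / (1 - \<rho>)) = (S * ?Q)\<^sup>2"
    using \<rho> by (simp add: S_def power_mult_distrib flip: \<rho>_def)
  finally have low': "sqrt ((norm (low f))\<^sup>2 + (\<Sum>i<j. (2 powr ((real i + 1) * real r) * norm (band f i))\<^sup>2)) \<le> S * ?Q"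
    using S M by (intro real_le_lsqrt) (auto simp: mult_left_mono intro!: mult_nonneg_nonneg add_nonneg_nonneg sum_nonneg)
  assume t: "0 \<le> t" "t \<le> 2 powr (- (real j * real r))"
  have "K_functional (power_op r) t f \<le> S * M * 2 powr (- (real j * \<alpha>)) + 2 * 2 powr (- (real j * real r)) * (S * ?Q)"
    using S M by (intro order_trans[OF K_le_dyadic[OF t(1), of r f j]] add_mono mult_mono high' low' t)
      (auto intro!: add_nonneg_nonneg sum_nonneg)
  also have "\<dots> = (1 + 2 * 2 powr real r) * S * M * 2 powr (- (real j * \<alpha>))"
  proof -
    \<comment> \<open>The restriction of t to at most 2^(-jr) brings the low part to the same size
      2^(-j \<alpha>) as the high part.\<close>
    have "2 powr (- (real j * real r)) * 2 powr (real j * (real r - \<alpha>)) = 2 powr (- (real j * \<alpha>))"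
      by (simp add: algebra_simps flip: powr_add)
    then have "2 * 2 powr (- (real j * real r)) * (S * ?Q) = 2 * 2 powr real r * S * M * 2 powr (- (real j * \<alpha>))"
      by (metis (no_types, lifting) mult.assoc mult.left_commute)
    then show ?thesis by (simp add: distrib_right)
  qed
  finally show "K_functional (power_op r) t f \<le> (1 + 2 * 2 powr real r) * S * M * 2 powr (- (real j * \<alpha>))" .
qed
end

section \<open>Dyadic norms and interpolation norms\<close>

lemma suminf_swap_ennreal: "(\<Sum>j. \<Sum>i. f i j) = (\<Sum>i. \<Sum>j. f i j)" for f :: "nat \<Rightarrow> nat \<Rightarrow> ennreal"
  using nn_integral_suminf[of f "count_space UNIV"] by (simp add: nn_integral_count_space_nat)

lemma le_suminf_ennreal: "f i \<le> (\<Sum>i. f i)" for f :: "nat \<Rightarrow> ennreal"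
  using sum_le_suminf[of f "{i}"] by simp

text \<open>Each side of i contributes at most one geometric series. The bound does not depend on i,
  which is what summing the damped coefficients requires.\<close>

lemma suminf_two_sided_geometric_le:
  fixes \<eta> :: real
  assumes "0 \<le> \<eta>" "\<eta> < 1"
  shows "(\<Sum>j. ennreal (\<eta> ^ nat \<bar>int i - int j\<bar>)) \<le> ennreal (2 / (1 - \<eta>))"
proof -
  let ?f = "\<lambda>j. \<eta> ^ nat \<bar>int i - int j\<bar>"
  have "(\<lambda>j. ?f (j + i)) sums (1 / (1 - \<eta>))"
    using geometric_sums[of \<eta>] assms by simp
  then have "?f sums (1 / (1 - \<eta>) + (\<Sum>j<i. ?f j))"
    by (rule iffD1[OF sums_iff_shift])
  then have "(\<Sum>j. ennreal (?f j)) = ennreal (1 / (1 - \<eta>) + (\<Sum>j<i. ?f j))"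
    using assms by (intro suminf_ennreal_eq) auto
  also have "(\<Sum>j<i. ?f j) = (\<Sum>j<i. \<eta> ^ Suc j)"
    by (rule sum.reindex_bij_witness[of _ "\<lambda>k. i - Suc k" "\<lambda>k. i - Suc k"])
       (auto simp: of_nat_diff nat_diff_distrib Suc_diff_Suc)
  also have "\<dots> \<le> (\<Sum>j<i. \<eta> ^ j)"
    using assms by (intro sum_mono power_decreasing) auto
  also have "\<dots> \<le> (\<Sum>j. \<eta> ^ j)"
    using assms by (intro sum_le_suminf summable_geometric) auto
  also have "\<dots> = 1 / (1 - \<eta>)"
    using assms by (simp add: suminf_geometric)
  finally show ?thesis by (simp add: ennreal_leI)
qed

lemma ennreal_powr_mono: "x \<le> y \<Longrightarrow> 0 \<le> a \<Longrightarrow> ennreal_powr x a \<le> ennreal_powr y a"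
  by (auto simp: ennreal_powr_def top_unique less_top intro!: ennreal_leI powr_mono2 enn2real_mono)

lemma ennreal_powr_ennreal: "0 \<le> x \<Longrightarrow> ennreal_powr (ennreal x) a = ennreal (x powr a)"
  by (simp add: ennreal_powr_def)

lemma ennreal_powr_cmult: "0 < C \<Longrightarrow> ennreal_powr (ennreal C * x) a = ennreal (C powr a) * ennreal_powr x a"
  by (cases x) (auto simp: ennreal_powr_ennreal powr_mult ennreal_mult ennreal_powr_def ennreal_mult_top
      simp flip: ennreal_mult)

text \<open>This and the next lemma compare integrals with dyadic sums through step functions.
  Monotonicity of the nonnegative integral suffices, so measurability of the K-functional in t never
  enters.\<close>

lemma nn_integral_le_suminf_steps:
  fixes c :: "nat \<Rightarrow> ennreal"
  assumes "\<And>t. g t \<le> (\<Sum>j. c j * indicator (A j) t)" and [measurable]: "\<And>j. A j \<in> sets M"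
  shows "(\<integral>\<^sup>+t. g t \<partial>M) \<le> (\<Sum>j. c j * emeasure M (A j))"
proof -
  have "(\<integral>\<^sup>+t. g t \<partial>M) \<le> (\<integral>\<^sup>+t. (\<Sum>j. c j * indicator (A j) t) \<partial>M)"
    by (rule nn_integral_mono) (rule assms)
  also have "\<dots> = (\<Sum>j. \<integral>\<^sup>+t. c j * indicator (A j) t \<partial>M)"
    by (rule nn_integral_suminf) measurable
  also have "\<dots> = (\<Sum>j. c j * emeasure M (A j))"
    by (simp add: nn_integral_cmult_indicator)
  finally show ?thesis .
qed

lemma suminf_steps_le_nn_integral:
  fixes c :: "nat \<Rightarrow> ennreal"
  assumes "\<And>t j. t \<in> A j \<Longrightarrow> c j \<le> g t" and "disjoint_family A" and [measurable]: "\<And>j. A j \<in> sets M"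
  shows "(\<Sum>j. c j * emeasure M (A j)) \<le> (\<integral>\<^sup>+t. g t \<partial>M)"
proof -
  have "(\<Sum>j. c j * emeasure M (A j)) = (\<Sum>j. \<integral>\<^sup>+t. c j * indicator (A j) t \<partial>M)"
    by (simp add: nn_integral_cmult_indicator)
  also have "\<dots> = (\<integral>\<^sup>+t. (\<Sum>j. c j * indicator (A j) t) \<partial>M)"
    by (rule nn_integral_suminf[symmetric]) measurable
  also have "\<dots> \<le> (\<integral>\<^sup>+t. g t \<partial>M)"
  proof (rule nn_integral_mono)
    fix t
    show "(\<Sum>j. c j * indicator (A j) t) \<le> g t"
    proof (cases "\<exists>j. t \<in> A j")
      case True
      then obtain j where "t \<in> A j" by blast
      then show ?thesis using suminf_cmult_indicator[OF assms(2), of t j c] assms(1) by simp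
    next
      case False
      then show ?thesis by simp
    qed
  qed
  finally show ?thesis .
qed

section \<open>Dyadic scales of the interpolation parameter\<close>

definition scale :: "nat \<Rightarrow> int \<Rightarrow> real set"
  where "scale r k = {2 powr (of_int k * real r)<..2 powr ((of_int k + 1) * real r)}"

lemma sets_scale [measurable]: "scale r k \<in> sets borel"
  by (simp add: scale_def)

lemma scale_cover:
  assumes "0 < t" "0 < r"
  obtains k where "t \<in> scale r k"
proof
  define x where "x = log 2 t / real r"
  have t: "t = 2 powr (x * real r)" using assms by (simp add: x_def)
  \<comment> \<open>The scale is open on the left, hence the ceiling minus one rather than the
    floor.\<close>
  have x: "of_int (\<lceil>x\<rceil> - 1) < x" "x \<le> of_int (\<lceil>x\<rceil> - 1) + 1" by linarith+
  show "t \<in> scale r (\<lceil>x\<rceil> - 1)"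
    unfolding scale_def t using assms(2) x by (auto intro!: powr_less_mono powr_mono mult_strict_right_mono mult_right_mono simp del: of_int_diff)
qed

lemma scale_disjoint: "k \<noteq> l \<Longrightarrow> scale r k \<inter> scale r l = {}"
proof -
  have *: "scale r k \<inter> scale r l = {}" if "k < l" for k l
  proof -
    have "2 powr ((of_int k + 1) * real r) \<le> 2 powr (of_int l * real r)"
      using that by (intro powr_mono mult_right_mono) auto
    then show ?thesis by (auto simp: scale_def)
  qed
  show "k \<noteq> l \<Longrightarrow> scale r k \<inter> scale r l = {}" using *[of k l] *[of l k] by (auto simp: Int_commute neq_iff)
qed

text \<open>The length is proportional to the left end, so it cancels the factor 1/t of the
  integrand up to constants.\<close>

lemma emeasure_scale: "emeasure lborel (scale r k) = ennreal (2 powr (of_int k * real r) * (2 powr real r - 1))"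
proof -
  have "2 powr (of_int k * real r) \<le> 2 powr ((of_int k + 1) * real r)"
    by (intro powr_mono mult_right_mono) auto
  then show ?thesis by (simp add: scale_def distrib_right powr_add algebra_simps)
qed

section \<open>Comparison of the K-functional with the dyadic sums\<close>

context nonneg_pvm begin

abbreviation coeff :: "real \<Rightarrow> 'a \<Rightarrow> nat \<Rightarrow> real" where
  "coeff \<alpha> f j \<equiv> 2 powr (real j * \<alpha>) * norm (band f j)"

abbreviation K_integral :: "real \<Rightarrow> nat \<Rightarrow> real \<Rightarrow> 'a \<Rightarrow> ennreal" where
  "K_integral \<alpha> r q f \<equiv> (\<integral>\<^sup>+ t\<in>{0<..}.
     ennreal ((t powr (- (\<alpha> / real r)) * K_functional (power_op r) t f) powr q / t) \<partial>lborel)"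

text \<open>For t in scale -j, monotonicity bounds K at t below by K at 2^(-jr), hence by the j-th
  band. Both powers of t are taken at the right end 2^((1-j)r), which costs 2^(\<alpha> q) and
  2^r.\<close>

lemma coeff_sum_le_K_integral:
  assumes "0 < \<alpha>" "0 < r" "0 < q"
  shows "(\<Sum>j. ennreal (coeff \<alpha> f j powr q)) \<le> ennreal (2 powr (\<alpha> * q + real r)) * K_integral \<alpha> r q f"
proof -
  define c where "c j = (2 powr (- \<alpha>) * coeff \<alpha> f j) powr q * 2 powr ((real j - 1) * real r)" for j
  let ?g = "\<lambda>t. ennreal ((t powr (- (\<alpha> / real r)) * K_functional (power_op r) t f) powr q / t) * indicator {0<..} t"
  have "(\<Sum>j. ennreal (c j) * emeasure lborel (scale r (- int j))) \<le> (\<integral>\<^sup>+t. ?g t \<partial>lborel)"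
  proof (rule suminf_steps_le_nn_integral)
    show "disjoint_family (\<lambda>j. scale r (- int j))"
      unfolding disjoint_family_on_def using scale_disjoint by simp
    show "scale r (- int j) \<in> sets lborel" for j by simp
    fix t j assume "t \<in> scale r (- int j)"
    then have t: "2 powr (- (real j * real r)) < t" "t \<le> 2 powr ((1 - real j) * real r)"
      by (simp_all add: scale_def)
    have "0 < t" using t(1) powr_ge_zero[of 2 "- (real j * real r)"] by linarith
    have K: "norm (band f j) \<le> K_functional (power_op r) t f"
      using norm_band_le_K K_mono t(1) by (meson less_imp_le order_trans powr_ge_zero)
    have "2 powr ((real j - 1) * \<alpha>) = (2 powr ((1 - real j) * real r)) powr (- (\<alpha> / real r))"
    proof -
      have "(1 - real j) * real r * (- (\<alpha> / real r)) = (real j - 1) * \<alpha>"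
        using assms(2) by (simp add: field_simps)
      then show ?thesis by (simp only: powr_powr)
    qed
    also have "\<dots> \<le> t powr (- (\<alpha> / real r))"
      using t(2) \<open>0 < t\<close> assms by (intro powr_mono2') auto
    finally have "2 powr ((real j - 1) * \<alpha>) * norm (band f j) \<le> t powr (- (\<alpha> / real r)) * K_functional (power_op r) t f"
      using K by (intro mult_mono) auto
    also have "2 powr ((real j - 1) * \<alpha>) * norm (band f j) = 2 powr (- \<alpha>) * coeff \<alpha> f j"
      by (simp add: algebra_simps flip: powr_add)
    finally have "(2 powr (- \<alpha>) * coeff \<alpha> f j) powr q \<le> (t powr (- (\<alpha> / real r)) * K_functional (power_op r) t f) powr q"
      using assms(3) by (intro powr_mono2) auto
    moreover have "2 powr ((real j - 1) * real r) \<le> 1 / t"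
    proof -
      have "2 powr ((real j - 1) * real r) = 1 / 2 powr ((1 - real j) * real r)"
        by (simp add: powr_minus_divide[symmetric] algebra_simps)
      also have "\<dots> \<le> 1 / t" using t(2) \<open>0 < t\<close> by (intro divide_left_mono) auto
      finally show ?thesis .
    qed
    ultimately have "c j \<le> (t powr (- (\<alpha> / real r)) * K_functional (power_op r) t f) powr q * (1 / t)"
      unfolding c_def by (intro mult_mono) auto
    then show "ennreal (c j) \<le> ?g t" using \<open>0 < t\<close> by (simp add: ennreal_leI)
  qed
  then have steps: "ennreal (2 powr (\<alpha> * q + real r)) * (\<Sum>j. ennreal (c j) * emeasure lborel (scale r (- int j)))
      \<le> ennreal (2 powr (\<alpha> * q + real r)) * (\<integral>\<^sup>+t. ?g t \<partial>lborel)"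
    by (rule mult_left_mono) simp
  have le: "ennreal (coeff \<alpha> f j powr q) \<le>
     ennreal (2 powr (\<alpha> * q + real r)) * (ennreal (c j) * emeasure lborel (scale r (- int j)))" for j
  proof -
    \<comment> \<open>As r is at least 1, the length of scale -j is at least 2^(-jr), and no further
      constant is lost.\<close>
    have "(2::real) powr 1 \<le> 2 powr real r" using assms(2) by (intro powr_mono) auto
    then have "1 \<le> (2::real) powr real r - 1" by simp
    then have "coeff \<alpha> f j powr q * 1 \<le> coeff \<alpha> f j powr q * (2 powr real r - 1)"
      by (intro mult_left_mono) auto
    also have "\<dots> = (2 powr (\<alpha> * q + real r) * ((2 powr (- \<alpha>)) powr q * 2 powr ((real j - 1) * real r)) * 2 powr (- real j * real r))
        * (coeff \<alpha> f j powr q * (2 powr real r - 1))"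
    proof -
      have "2 powr (\<alpha> * q + real r) * ((2 powr (- \<alpha>)) powr q * 2 powr ((real j - 1) * real r)) * 2 powr (- real j * real r) = 1"
        by (simp add: powr_powr algebra_simps flip: powr_add)
      then show ?thesis by (simp only: mult_1)
    qed
    also have "\<dots> = 2 powr (\<alpha> * q + real r) * (c j * (2 powr (- real j * real r) * (2 powr real r - 1)))"
    proof -
      have "c j = (2 powr (- \<alpha>)) powr q * 2 powr ((real j - 1) * real r) * coeff \<alpha> f j powr q"
        by (simp add: c_def powr_mult mult_ac)
      then show ?thesis by (simp only: mult_ac)
    qed
    finally show ?thesis
      using \<open>1 \<le> 2 powr real r - 1\<close> by (simp add: emeasure_scale ennreal_leI c_def flip: ennreal_mult)
  qed
  have "(\<Sum>j. ennreal (coeff \<alpha> f j powr q)) \<le>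
      (\<Sum>j. ennreal (2 powr (\<alpha> * q + real r)) * (ennreal (c j) * emeasure lborel (scale r (- int j))))"
    by (intro suminf_le summableI le)
  also note ennreal_suminf_cmult
  also note steps
  finally show ?thesis .
qed

text \<open>Scales with t at most 1 use the weighted bound on K with a number depending on the
  scale; for t above 1, K is at most the norm of f and the weight is integrable because \<alpha> is
  positive.\<close>

lemma K_integral_le_coeff_sum:
  assumes \<alpha>: "0 < \<alpha>" "\<alpha> < real r" and q: "0 < q"
  obtains C where "0 < C" and
    "\<And>f. ennreal (norm f powr q) \<le> ennreal C * (ennreal (norm (low f) powr q) + (\<Sum>j. ennreal (coeff \<alpha> f j powr q)))"
    "\<And>f. K_integral \<alpha> r q f \<le> ennreal C * (ennreal (norm (low f) powr q) + (\<Sum>j. ennreal (coeff \<alpha> f j powr q)))"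
proof -
  define \<epsilon> where "\<epsilon> = min \<alpha> (real r - \<alpha>) / 2"
  have \<epsilon>: "0 < \<epsilon>" "2 * \<epsilon> \<le> \<alpha>" "2 * \<epsilon> \<le> real r - \<alpha>" using \<alpha> by (auto simp: \<epsilon>_def)
  have r: "0 < r" using \<alpha> by (cases r) auto
  define S where "S = sqrt (2 / (1 - (2 powr (- \<epsilon>))\<^sup>2))"
  have "2 powr (- \<epsilon>) < 2 powr (0::real)" using \<epsilon> by (intro powr_less_mono) auto
  then have S: "0 \<le> S" by (auto simp: S_def power_le_one)
  define C1 where "C1 = (1 + 2 * 2 powr real r) * S"
  have C1: "0 \<le> C1" using S by (simp add: C1_def)
  \<comment> \<open>The damping 2^(-\<epsilon>) per scale, raised to the power q; \<beta> below is
    the decay of the weight per scale for t above 1.\<close>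
  define \<eta> where "\<eta> = 2 powr (- (\<epsilon> * q))"
  have \<eta>: "0 < \<eta>" "\<eta> < 1"
    using \<epsilon> q powr_less_mono[of "- (\<epsilon> * q)" 0 2] by (auto simp: \<eta>_def)
  define \<beta> where "\<beta> = 2 powr (- (\<alpha> * q))"
  have \<beta>: "0 < \<beta>" "\<beta> < 1"
    using \<alpha> q powr_less_mono[of "- (\<alpha> * q)" 0 2] by (auto simp: \<beta>_def)
  have \<eta>_power: "\<eta> ^ n = 2 powr (- (\<epsilon> * real n * q))" for n
    by (simp add: \<eta>_def powr_powr mult_ac flip: powr_realpow)
  define CA where "CA = (2 powr \<alpha> * C1) powr q * 2 powr real r * (2 / (1 - \<eta>))"
  define CN where "CN = (1 + S) powr q"
  define CB where "CB = CN * 2 powr real r * (1 / (1 - \<beta>))"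
  define C where "C = 1 + CN + CA + CB"
  have pos: "0 \<le> CA" "0 \<le> CN" "0 \<le> CB" using \<eta> \<beta> by (auto simp: CA_def CN_def CB_def)
  then have C: "0 < C" by (simp add: C_def)
  have "ennreal (norm f powr q) \<le> ennreal C * (ennreal (norm (low f) powr q) + (\<Sum>j. ennreal (coeff \<alpha> f j powr q)))
    \<and> K_integral \<alpha> r q f \<le> ennreal C * (ennreal (norm (low f) powr q) + (\<Sum>j. ennreal (coeff \<alpha> f j powr q)))"
    (is "_ \<le> _ * ?X \<and> _ \<le> _ * ?X") for f
  \<comment> \<open>An infinite right-hand side is trivial. Otherwise each damped sum is at most
    \<open>?X\<close>, hence a real number whose root can be taken.\<close>
  proof (cases "?X = top")
    case True
    then show ?thesis using C by (simp add: ennreal_mult_top)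
  next
    case False
    let ?G = "norm (low f) powr q" and ?d = "\<lambda>i j. nat \<bar>int i - int j\<bar>"
    \<comment> \<open>The low piece is treated like a coefficient at index 0, so its damping at
      scale j is \<open>\<eta> ^ j\<close>.\<close>
    define E where "E j = ennreal (\<eta> ^ j) * ennreal ?G + (\<Sum>i. ennreal (\<eta> ^ ?d i j) * ennreal (coeff \<alpha> f i powr q))" for j
    have damp: "ennreal (\<eta> ^ n) * y \<le> y" for n y
    proof -
      have "ennreal (\<eta> ^ n) \<le> 1" using \<eta> by (simp add: ennreal_le_1 power_le_one)
      then have "ennreal (\<eta> ^ n) * y \<le> 1 * y" by (rule mult_right_mono) simp
      then show ?thesis by simp
    qed
    have E_le: "E j \<le> ?X" for j
      unfolding E_def by (intro add_mono suminf_le summableI damp)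
    define m where "m j = enn2real (E j)" for j
    have Em: "E j = ennreal (m j)" for j
    proof -
      have "E j \<noteq> top" using E_le[of j] False by (metis neq_top_trans)
      then show ?thesis by (simp add: m_def less_top)
    qed
    have m0: "0 \<le> m j" for j by (simp add: m_def)
    \<comment> \<open>A single number that dominates the damped coefficients around the scale \<open>j\<close>; summing its
      \<open>q\<close>-th powers over \<open>j\<close> replaces the discrete Hardy inequality.\<close>
    define M where "M j = m j powr (1 / q)" for j
    have M0: "0 \<le> M j" for j by (simp add: M_def)
    have M_powr: "M j powr q = m j" for j using q m0 by (simp add: M_def powr_powr)
    \<comment> \<open>One term of the damped sum is at most the whole sum; taking q-th roots undoes
      the damping.\<close>
    have band_M: "coeff \<alpha> f i \<le> M j * 2 powr (\<epsilon> * \<bar>real i - real j\<bar>)" for i j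
    proof -
      have "ennreal (\<eta> ^ ?d i j * coeff \<alpha> f i powr q) \<le> (\<Sum>i. ennreal (\<eta> ^ ?d i j) * ennreal (coeff \<alpha> f i powr q))"
        using \<eta> le_suminf_ennreal[of "\<lambda>i. ennreal (\<eta> ^ ?d i j) * ennreal (coeff \<alpha> f i powr q)" i]
        by (simp add: ennreal_mult)
      also have "\<dots> \<le> E j" by (simp add: E_def)
      finally have "\<eta> ^ ?d i j * coeff \<alpha> f i powr q \<le> m j" using m0 by (simp add: Em)
      moreover have "\<eta> ^ ?d i j * coeff \<alpha> f i powr q = (2 powr (- (\<epsilon> * \<bar>real i - real j\<bar>)) * coeff \<alpha> f i) powr q"
        by (simp add: \<eta>_power powr_mult powr_powr)
      ultimately have "((2 powr (- (\<epsilon> * \<bar>real i - real j\<bar>)) * coeff \<alpha> f i) powr q) powr (1 / q) \<le> M j"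
        unfolding M_def using q by (intro powr_mono2) auto
      then have "2 powr (- (\<epsilon> * \<bar>real i - real j\<bar>)) * coeff \<alpha> f i \<le> M j"
        using q by (simp add: powr_powr)
      then show ?thesis by (simp add: powr_minus field_simps)
    qed
    have low_M: "norm (low f) \<le> M j * 2 powr (\<epsilon> * real j)" for j
    proof -
      have "ennreal (\<eta> ^ j * ?G) \<le> E j" using \<eta> by (simp add: E_def ennreal_mult)
      then have "\<eta> ^ j * ?G \<le> m j" using m0 by (simp add: Em)
      moreover have "\<eta> ^ j * ?G = (2 powr (- (\<epsilon> * real j)) * norm (low f)) powr q"
        by (simp add: \<eta>_power powr_mult powr_powr)
      ultimately have "((2 powr (- (\<epsilon> * real j)) * norm (low f)) powr q) powr (1 / q) \<le> M j"
        unfolding M_def using q by (intro powr_mono2) auto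
      then have "2 powr (- (\<epsilon> * real j)) * norm (low f) \<le> M j"
        using q by (simp add: powr_powr)
      then show ?thesis by (simp add: powr_minus field_simps)
    qed
    \<comment> \<open>After the exchange of sums, each coefficient carries the total of its dampings
      over all j.\<close>
    have sum_E: "(\<Sum>j. E j) \<le> ennreal (2 / (1 - \<eta>)) * ?X"
    proof -
      have "(\<Sum>j. ennreal (\<eta> ^ j)) \<le> ennreal (2 / (1 - \<eta>))"
        using suminf_two_sided_geometric_le[of \<eta> 0] \<eta> by (simp only: of_nat_0 diff_0 abs_minus_cancel abs_of_nat nat_int)
      then have 1: "(\<Sum>j. ennreal (\<eta> ^ j) * ennreal ?G) \<le> ennreal (2 / (1 - \<eta>)) * ennreal ?G"
        unfolding ennreal_suminf_multc by (rule mult_right_mono) simp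
      have "(\<Sum>j. \<Sum>i. ennreal (\<eta> ^ ?d i j) * ennreal (coeff \<alpha> f i powr q)) =
          (\<Sum>i. (\<Sum>j. ennreal (\<eta> ^ ?d i j)) * ennreal (coeff \<alpha> f i powr q))"
        by (subst suminf_swap_ennreal) simp
      also have "\<dots> \<le> (\<Sum>i. ennreal (2 / (1 - \<eta>)) * ennreal (coeff \<alpha> f i powr q))"
        using \<eta> by (intro suminf_le summableI mult_right_mono suminf_two_sided_geometric_le) auto
      also have "\<dots> = ennreal (2 / (1 - \<eta>)) * (\<Sum>i. ennreal (coeff \<alpha> f i powr q))" by simp
      finally show ?thesis
        using 1 unfolding E_def by (subst suminf_add[OF summableI summableI, symmetric]) (simp only: distrib_left add_mono)
    qed
    \<comment> \<open>At scale 0 the low-pass vector is \<open>low f\<close>.\<close>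
    have norm_M: "norm f \<le> (1 + S) * M 0"
    proof -
      have "norm f \<le> norm (low f) + norm (f - low f)"
        using norm_triangle_ineq[of "low f" "f - low f"] by simp
      also have "norm (f - low f) \<le> S * M 0"
        using K_le_of_weighted_bound(1)[OF \<epsilon> M0[of 0] band_M low_M] by (simp add: low_def S_def)
      also have "norm (low f) \<le> M 0" using low_M[of 0] by simp
      finally show ?thesis by (simp add: algebra_simps)
    qed
    have norm_q: "norm f powr q \<le> CN * m 0"
    proof -
      have "norm f powr q \<le> ((1 + S) * M 0) powr q" using norm_M q by (intro powr_mono2) auto
      also have "\<dots> = CN * m 0" using S M0[of 0] by (simp add: CN_def powr_mult M_powr)
      finally show ?thesis .
    qed
    have "ennreal (norm f powr q) \<le> ennreal CN * E 0"
      using norm_q pos m0 by (simp add: Em ennreal_leI flip: ennreal_mult)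
    also have "\<dots> \<le> ennreal C * ?X"
      using pos by (intro mult_mono E_le ennreal_leI) (auto simp: C_def)
    finally have norm_X: "ennreal (norm f powr q) \<le> ennreal C * ?X" .

    let ?g = "\<lambda>t. ennreal ((t powr (- (\<alpha> / real r)) * K_functional (power_op r) t f) powr q / t) * indicator {0<..} t"
    \<comment> \<open>\<open>a j\<close> belongs to scale -(j+1), whose right end 2^(-jr) is where K
      is estimated, while the powers of t are taken at the left end; this shift produces 2^\<alpha>
      and the exponent \<open>Suc j\<close>. \<open>b j\<close> belongs to scale j, with t above
      1.\<close>
    define a where "a j = (2 powr \<alpha> * C1) powr q * m j * 2 powr (real (Suc j) * real r)" for j
    define b where "b j = \<beta> ^ j * norm f powr q * 2 powr (- (real j * real r))" for j
    have ab: "0 \<le> a j" "0 \<le> b j" for j using m0[of j] \<beta> by (auto simp: a_def b_def)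
    have bound: "(t powr (- (\<alpha> / real r)) * K_functional (power_op r) t f) powr q / t \<le>
        (2 powr (- (of_int k * \<alpha>)) * B) powr q * 2 powr (- (of_int k * real r))"
      if t: "t \<in> scale r k" and B: "K_functional (power_op r) t f \<le> B" for t k B
    proof -
      have t: "2 powr (of_int k * real r) < t" using t by (simp add: scale_def)
      then have t0: "0 < t" using powr_ge_zero[of 2 "of_int k * real r"] by linarith
      have "t powr (- (\<alpha> / real r)) \<le> (2 powr (of_int k * real r)) powr (- (\<alpha> / real r))"
        using t \<alpha> by (intro powr_mono2') auto
      also have "\<dots> = 2 powr (- (of_int k * \<alpha>))" using r by (simp add: powr_powr)
      finally have "t powr (- (\<alpha> / real r)) * K_functional (power_op r) t f \<le> 2 powr (- (of_int k * \<alpha>)) * B"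
        using B K_nonneg[of t r f] t0 by (intro mult_mono) auto
      then have "(t powr (- (\<alpha> / real r)) * K_functional (power_op r) t f) powr q \<le> (2 powr (- (of_int k * \<alpha>)) * B) powr q"
        using q t0 K_nonneg[of t r f] by (intro powr_mono2) auto
      moreover have "1 / t \<le> 2 powr (- (of_int k * real r))"
        using t t0 by (simp add: powr_minus field_simps)
      ultimately have "(t powr (- (\<alpha> / real r)) * K_functional (power_op r) t f) powr q * (1 / t) \<le>
        (2 powr (- (of_int k * \<alpha>)) * B) powr q * 2 powr (- (of_int k * real r))"
        using t0 by (intro mult_mono) auto
      then show ?thesis by simp
    qed
    have pointwise: "?g t \<le> (\<Sum>j. ennreal (a j) * indicator (scale r (- int (Suc j))) t)
        + (\<Sum>j. ennreal (b j) * indicator (scale r (int j)) t)" for t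
    proof (cases "0 < t")
      case False
      then show ?thesis by simp
    next
      case True
      then obtain k where k: "t \<in> scale r k" using scale_cover r by blast
      show ?thesis
      proof (cases "0 \<le> k")
        case True
        then obtain j where j: "k = int j" using nonneg_int_cases by blast
        have "(t powr (- (\<alpha> / real r)) * K_functional (power_op r) t f) powr q / t \<le>
           (2 powr (- (of_int k * \<alpha>)) * norm f) powr q * 2 powr (- (of_int k * real r))"
          using \<open>0 < t\<close> by (intro bound k K_le_norm) simp
        also have "\<dots> = b j"
          by (simp add: b_def \<beta>_def j powr_mult powr_powr mult_ac flip: powr_realpow)
        finally have "?g t \<le> ennreal (b j) * indicator (scale r (int j)) t"
          using k \<open>0 < t\<close> by (simp add: j ennreal_leI)
        also have "\<dots> \<le> (\<Sum>j. ennreal (b j) * indicator (scale r (int j)) t)"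
          by (rule le_suminf_ennreal)
        finally show ?thesis by (simp add: add_increasing)
      next
        case False
        define j where "j = nat (- k - 1)"
        have j: "k = - int (Suc j)" using False by (simp add: j_def)
        have "t \<le> 2 powr (- (real j * real r))" using k by (simp add: scale_def j)
        then have "K_functional (power_op r) t f \<le> C1 * M j * 2 powr (- (real j * \<alpha>))"
          using K_le_of_weighted_bound(2)[OF \<epsilon> M0[of j] band_M low_M] \<open>0 < t\<close>
          by (simp add: C1_def S_def)
        then have "(t powr (- (\<alpha> / real r)) * K_functional (power_op r) t f) powr q / t \<le>
           (2 powr (- (of_int k * \<alpha>)) * (C1 * M j * 2 powr (- (real j * \<alpha>)))) powr q * 2 powr (- (of_int k * real r))"
          by (intro bound k)
        also have "2 powr (- (of_int k * \<alpha>)) * (C1 * M j * 2 powr (- (real j * \<alpha>))) = 2 powr \<alpha> * C1 * M j"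
          by (simp add: j powr_minus powr_add algebra_simps)
        also have "- (of_int k * real r) = real (Suc j) * real r"
          by (simp add: j algebra_simps)
        also have "(2 powr \<alpha> * C1 * M j) powr q * 2 powr (real (Suc j) * real r) = a j"
          using C1 M0[of j] by (simp add: a_def powr_mult M_powr)
        finally have "?g t \<le> ennreal (a j) * indicator (scale r (- int (Suc j))) t"
          using k \<open>0 < t\<close> by (simp add: j ennreal_leI del: of_nat_Suc)
        also have "\<dots> \<le> (\<Sum>j. ennreal (a j) * indicator (scale r (- int (Suc j))) t)"
          by (rule le_suminf_ennreal)
        finally show ?thesis by (simp add: add_increasing2)
      qed
    qed
    have "(\<integral>\<^sup>+t. ?g t \<partial>lborel) \<le> (\<integral>\<^sup>+t. (\<Sum>j. ennreal (a j) * indicator (scale r (- int (Suc j))) t)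
        + (\<Sum>j. ennreal (b j) * indicator (scale r (int j)) t) \<partial>lborel)"
      by (rule nn_integral_mono) (rule pointwise)
    also have "\<dots> = (\<integral>\<^sup>+t. (\<Sum>j. ennreal (a j) * indicator (scale r (- int (Suc j))) t) \<partial>lborel)
        + (\<integral>\<^sup>+t. (\<Sum>j. ennreal (b j) * indicator (scale r (int j)) t) \<partial>lborel)"
      by (rule nn_integral_add) measurable
    also have "\<dots> \<le> (\<Sum>j. ennreal (a j) * emeasure lborel (scale r (- int (Suc j))))
        + (\<Sum>j. ennreal (b j) * emeasure lborel (scale r (int j)))"
      by (intro add_mono nn_integral_le_suminf_steps) auto
    \<comment> \<open>The lengths of the scales cancel the powers of 2 from 1/t up to 2^r. What
      remains is the damped sums for small t and a geometric series for large t.\<close>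
    also have "\<dots> \<le> (\<Sum>j. ennreal ((2 powr \<alpha> * C1) powr q * 2 powr real r) * E j)
        + (\<Sum>j. ennreal (CN * 2 powr real r) * E 0 * ennreal (\<beta> ^ j))"
    proof (intro add_mono suminf_le summableI)
      fix j
      have "a j * (2 powr (- (real (Suc j) * real r)) * (2 powr real r - 1)) =
          (2 powr \<alpha> * C1) powr q * m j * (2 powr real r - 1) * (2 powr (real (Suc j) * real r) * 2 powr (- (real (Suc j) * real r)))"
        by (simp only: a_def mult_ac)
      also have "\<dots> = (2 powr \<alpha> * C1) powr q * m j * (2 powr real r - 1)"
        by (simp flip: powr_add)
      also have "\<dots> \<le> (2 powr \<alpha> * C1) powr q * m j * 2 powr real r"
        using m0[of j] by (intro mult_left_mono) auto
      finally have "a j * (2 powr (- (real (Suc j) * real r)) * (2 powr real r - 1)) \<le> \<dots>" .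
      moreover have "emeasure lborel (scale r (- int (Suc j))) =
          ennreal (2 powr (- (real (Suc j) * real r)) * (2 powr real r - 1))"
        unfolding emeasure_scale by (simp add: algebra_simps)
      ultimately show "ennreal (a j) * emeasure lborel (scale r (- int (Suc j))) \<le> ennreal ((2 powr \<alpha> * C1) powr q * 2 powr real r) * E j"
        using ab[of j] m0[of j] ge_one_powr_ge_zero[of 2 "real r"]
        by (simp add: Em ennreal_leI mult_ac flip: ennreal_mult)
      have "b j * (2 powr (real j * real r) * (2 powr real r - 1)) =
          \<beta> ^ j * norm f powr q * (2 powr real r - 1) * (2 powr (- (real j * real r)) * 2 powr (real j * real r))"
        by (simp only: b_def mult_ac)
      also have "\<dots> = \<beta> ^ j * norm f powr q * (2 powr real r - 1)"
        by (simp flip: powr_add)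
      also have "\<dots> \<le> \<beta> ^ j * (CN * m 0) * 2 powr real r"
        using m0[of 0] \<beta> pos norm_q by (intro mult_mono) (auto simp: ge_one_powr_ge_zero)
      finally show "ennreal (b j) * emeasure lborel (scale r (int j)) \<le> ennreal (CN * 2 powr real r) * E 0 * ennreal (\<beta> ^ j)"
        using ab[of j] m0[of 0] \<beta> pos ge_one_powr_ge_zero[of 2 "real r"]
        by (simp add: emeasure_scale Em ennreal_leI mult_ac flip: ennreal_mult)
    qed
    also have "\<dots> \<le> ennreal CA * ?X + ennreal CB * ?X"
    proof (rule add_mono)
      have "(\<Sum>j. ennreal ((2 powr \<alpha> * C1) powr q * 2 powr real r) * E j) \<le>
          ennreal ((2 powr \<alpha> * C1) powr q * 2 powr real r) * (ennreal (2 / (1 - \<eta>)) * ?X)"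
        unfolding ennreal_suminf_cmult by (intro mult_left_mono sum_E) simp
      also have "\<dots> = ennreal ((2 powr \<alpha> * C1) powr q * 2 powr real r) * ennreal (2 / (1 - \<eta>)) * ?X"
        by (simp only: mult.assoc)
      also have "\<dots> = ennreal CA * ?X"
        unfolding CA_def using \<eta> by (subst ennreal_mult[symmetric]) auto
      finally show "(\<Sum>j. ennreal ((2 powr \<alpha> * C1) powr q * 2 powr real r) * E j) \<le> ennreal CA * ?X" .
      have "(\<Sum>j. ennreal (\<beta> ^ j)) = ennreal (1 / (1 - \<beta>))"
        using \<beta> geometric_sums[of \<beta>] by (intro suminf_ennreal_eq) auto
      then have "(\<Sum>j. ennreal (CN * 2 powr real r) * E 0 * ennreal (\<beta> ^ j)) =
          ennreal (CN * 2 powr real r) * ennreal (1 / (1 - \<beta>)) * E 0"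
        unfolding ennreal_suminf_cmult by (simp only: mult_ac)
      also have "\<dots> = ennreal CB * E 0"
        unfolding CB_def using \<beta> pos by (subst ennreal_mult[symmetric]) auto
      also have "\<dots> \<le> ennreal CB * ?X" by (intro mult_left_mono E_le) simp
      finally show "(\<Sum>j. ennreal (CN * 2 powr real r) * E 0 * ennreal (\<beta> ^ j)) \<le> ennreal CB * ?X" .
    qed
    also have "\<dots> \<le> ennreal C * ?X"
      using pos by (simp add: C_def flip: distrib_right ennreal_plus) (intro mult_right_mono ennreal_leI, auto)
    finally show ?thesis using norm_X by blast
  qed
  then show thesis using that C by blast
qed

lemma interpolation_norm_le_dyadic:
  assumes \<alpha>: "0 < \<alpha>" "\<alpha> < real r" and q: "1 \<le> q"
  shows "\<exists>C>0. \<forall>f. interpolation_norm (power_op r) (\<alpha> / real r) q f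
    \<le> ennreal C * (ennreal (norm (low f)) + dyadic_norm \<alpha> q (band f))"
proof (cases "q = \<infinity>")
  case True
  define \<epsilon> where "\<epsilon> = min \<alpha> (real r - \<alpha>) / 2"
  have \<epsilon>: "0 < \<epsilon>" "2 * \<epsilon> \<le> \<alpha>" "2 * \<epsilon> \<le> real r - \<alpha>" using \<alpha> by (auto simp: \<epsilon>_def)
  have r: "0 < r" using \<alpha> by (cases r) auto
  define S where "S = sqrt (2 / (1 - (2 powr (- \<epsilon>))\<^sup>2))"
  have "2 powr (- \<epsilon>) < 2 powr (0::real)" using \<epsilon> by (intro powr_less_mono) auto
  then have S: "0 \<le> S" by (auto simp: S_def power_le_one)
  define C1 where "C1 = (1 + 2 * 2 powr real r) * S"
  have C1: "0 \<le> C1" using S by (simp add: C1_def)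
  \<comment> \<open>One 1 + S bounds the norm of f in the interpolation norm, the other bounds the
    supremum over t above 1; the last term is for small t.\<close>
  define C where "C = 2 * (1 + S) + 2 powr \<alpha> * C1"
  have C: "0 < C" using S C1 by (simp add: C_def add_pos_nonneg)
  have "interpolation_norm (power_op r) (\<alpha> / real r) q f
    \<le> ennreal C * (ennreal (norm (low f)) + dyadic_norm \<alpha> q (band f))" for f
  proof (cases "dyadic_norm \<alpha> q (band f) = top")
    case True
    then show ?thesis using C by (simp add: ennreal_mult_top)
  next
    case False
    then obtain d where d: "0 \<le> d" "dyadic_norm \<alpha> q (band f) = ennreal d"
      by (metis less_top less_top_ennreal)
    define M where "M = norm (low f) + d"
    have M: "0 \<le> M" using d by (simp add: M_def)
    have coeff: "coeff \<alpha> f i \<le> M" for i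
    proof -
      have "ennreal (coeff \<alpha> f i) \<le> ennreal d"
        unfolding d(2)[symmetric] dyadic_norm_def if_P[OF \<open>q = \<infinity>\<close>] by (rule SUP_upper) simp
      then show ?thesis using d by (simp add: M_def add_increasing)
    qed
    \<comment> \<open>A bound uniform in i is in particular one with the growth that the weighted
      estimate admits.\<close>
    have ge1: "1 \<le> 2 powr (\<epsilon> * x)" if "0 \<le> x" for x
      using \<epsilon> that by (simp add: ge_one_powr_ge_zero)
    have band_M: "coeff \<alpha> f i \<le> M * 2 powr (\<epsilon> * \<bar>real i - real j\<bar>)" for i j
      using order_trans[OF coeff[of i]] mult_left_mono[OF ge1[of "\<bar>real i - real j\<bar>"] M] by simp
    have low_M: "norm (low f) \<le> M * 2 powr (\<epsilon> * real j)" for j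
      using mult_left_mono[OF ge1[of "real j"] M] d by (simp add: M_def)
    have norm_M: "norm f \<le> (1 + S) * M"
    proof -
      have "norm f \<le> norm (low f) + norm (f - low f)"
        using norm_triangle_ineq[of "low f" "f - low f"] by simp
      also have "norm (f - low f) \<le> S * M"
        using K_le_of_weighted_bound(1)[OF \<epsilon> M band_M low_M[of 0]] by (simp add: low_def S_def)
      also have "norm (low f) \<le> M" using low_M[of 0] by simp
      finally show ?thesis by (simp add: algebra_simps)
    qed
    have "t powr (- (\<alpha> / real r)) * K_functional (power_op r) t f \<le> (1 + S + 2 powr \<alpha> * C1) * M" if "0 < t" for t
    proof -
      obtain k where k: "t \<in> scale r k" using scale_cover \<open>0 < t\<close> r by blast
      then have t: "2 powr (of_int k * real r) < t" by (simp add: scale_def)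
      have "t powr (- (\<alpha> / real r)) \<le> (2 powr (of_int k * real r)) powr (- (\<alpha> / real r))"
        using t \<alpha> by (intro powr_mono2') auto
      also have "\<dots> = 2 powr (- (of_int k * \<alpha>))" using r by (simp add: powr_powr)
      finally have tp: "t powr (- (\<alpha> / real r)) \<le> 2 powr (- (of_int k * \<alpha>))" .
      show ?thesis
      proof (cases "0 \<le> k")
        case True
        then have "2 powr (- (of_int k * \<alpha>)) \<le> 2 powr 0" using \<alpha> by (intro powr_mono) auto
        then have "t powr (- (\<alpha> / real r)) \<le> 1" using tp by simp
        then have "t powr (- (\<alpha> / real r)) * K_functional (power_op r) t f \<le> 1 * norm f"
          using \<open>0 < t\<close> K_le_norm[of t r f] K_nonneg[of t r f] by (intro mult_mono) auto
        also have "\<dots> \<le> (1 + S + 2 powr \<alpha> * C1) * M"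
          using norm_M C1 M by (simp add: distrib_right add_increasing2)
        finally show ?thesis .
      next
        case False
        define j where "j = nat (- k - 1)"
        have j: "k = - int (Suc j)" using False by (simp add: j_def)
        have "t \<le> 2 powr (- (real j * real r))" using k by (simp add: scale_def j)
        then have "K_functional (power_op r) t f \<le> C1 * M * 2 powr (- (real j * \<alpha>))"
          using K_le_of_weighted_bound(2)[OF \<epsilon> M band_M low_M] \<open>0 < t\<close>
          by (simp add: C1_def S_def)
        then have "t powr (- (\<alpha> / real r)) * K_functional (power_op r) t f \<le>
            2 powr (- (of_int k * \<alpha>)) * (C1 * M * 2 powr (- (real j * \<alpha>)))"
          using tp \<open>0 < t\<close> K_nonneg[of t r f] by (intro mult_mono) auto
        also have "\<dots> = 2 powr \<alpha> * C1 * M"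
          by (simp add: j powr_minus powr_add algebra_simps)
        also have "\<dots> \<le> (1 + S + 2 powr \<alpha> * C1) * M"
          using S M by (simp add: distrib_right)
        finally show ?thesis .
      qed
    qed
    then have "(SUP t\<in>{0<..}. ennreal (t powr (- (\<alpha> / real r)) * K_functional (power_op r) t f))
        \<le> ennreal ((1 + S + 2 powr \<alpha> * C1) * M)"
      by (intro SUP_least ennreal_leI) simp
    then have "interpolation_norm (power_op r) (\<alpha> / real r) q f
      \<le> ennreal ((1 + S) * M) + ennreal ((1 + S + 2 powr \<alpha> * C1) * M)"
      unfolding interpolation_norm_def using \<open>q = \<infinity>\<close> norm_M
      by (simp add: add_mono ennreal_leI)
    also have "\<dots> = ennreal (C * M)"
      using S C1 M by (subst ennreal_plus[symmetric]) (auto simp: C_def algebra_simps)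
    also have "\<dots> = ennreal C * (ennreal (norm (low f)) + dyadic_norm \<alpha> q (band f))"
      using C d by (simp add: M_def ennreal_mult)
    finally show ?thesis .
  qed
  then show ?thesis using C by blast
next
  case False
  define p where "p = enn2real q"
  have p: "0 < p" using q False unfolding p_def
    by (cases q) (auto simp: ennreal_1[symmetric] simp del: ennreal_1)
  obtain C where C: "0 < C" and
    norm: "\<And>f. ennreal (norm f powr p) \<le> ennreal C * (ennreal (norm (low f) powr p) + (\<Sum>j. ennreal (coeff \<alpha> f j powr p)))" and
    K: "\<And>f. K_integral \<alpha> r p f \<le> ennreal C * (ennreal (norm (low f) powr p) + (\<Sum>j. ennreal (coeff \<alpha> f j powr p)))"
    using K_integral_le_coeff_sum[OF \<alpha> p] by blast
  \<comment> \<open>The outer 2 counts the two summands of the interpolation norm. The inner 2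
    arises because each of the two p-th powers is at most the p-th power of the sum
    \<open>N\<close>.\<close>
  define C' where "C' = 2 * (C * 2) powr (1 / p)"
  have "interpolation_norm (power_op r) (\<alpha> / real r) q f
    \<le> ennreal C' * (ennreal (norm (low f)) + dyadic_norm \<alpha> q (band f))" for f
  proof -
    define X where "X = (\<Sum>j. ennreal (coeff \<alpha> f j powr p))"
    have dyadic: "dyadic_norm \<alpha> q (band f) = ennreal_powr X (1 / p)"
      using False by (simp add: dyadic_norm_def X_def p_def)
    have root: "ennreal_powr Y (1 / p) \<le> ennreal ((C * 2) powr (1 / p)) * (ennreal (norm (low f)) + ennreal_powr X (1 / p))"
      if Y: "Y \<le> ennreal C * (ennreal (norm (low f) powr p) + X)" for Y
    proof (cases "X = top")
      case True
      then show ?thesis using C by (simp add: ennreal_powr_def ennreal_mult_top)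
    next
      case False
      then obtain x where x: "0 \<le> x" "X = ennreal x" by (metis less_top less_top_ennreal)
      define N where "N = norm (low f) + x powr (1 / p)"
      have "norm (low f) powr p \<le> N powr p" "(x powr (1 / p)) powr p \<le> N powr p"
        using p by (auto intro!: powr_mono2 simp: N_def)
      then have "norm (low f) powr p + x \<le> 2 * N powr p" using x p by (simp add: powr_powr)
      then have "ennreal C * (ennreal (norm (low f) powr p) + X) \<le> ennreal (C * (2 * N powr p))"
        using x C by (simp add: ennreal_leI flip: ennreal_plus ennreal_mult)
      with Y have "ennreal_powr Y (1 / p) \<le> ennreal_powr (ennreal (C * (2 * N powr p))) (1 / p)"
        using p by (intro ennreal_powr_mono) auto
      also have "\<dots> = ennreal ((C * 2) powr (1 / p) * N)"
        using C p x by (simp add: ennreal_powr_ennreal powr_mult powr_powr N_def)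
      also have "\<dots> = ennreal ((C * 2) powr (1 / p)) * (ennreal (norm (low f)) + ennreal_powr X (1 / p))"
        using x by (simp add: N_def ennreal_powr_ennreal ennreal_mult)
      finally show ?thesis .
    qed
    have "ennreal (norm f) = ennreal_powr (ennreal (norm f powr p)) (1 / p)"
      using p by (simp add: ennreal_powr_ennreal powr_powr)
    also have "\<dots> \<le> ennreal ((C * 2) powr (1 / p)) * (ennreal (norm (low f)) + ennreal_powr X (1 / p))"
      by (rule root) (use norm X_def in simp)
    finally have 1: "ennreal (norm f) \<le> \<dots>" .
    have "interpolation_norm (power_op r) (\<alpha> / real r) q f = ennreal (norm f) + ennreal_powr (K_integral \<alpha> r p f) (1 / p)"
      using False by (simp add: interpolation_norm_def p_def)
    also have "\<dots> \<le> ennreal ((C * 2) powr (1 / p)) * (ennreal (norm (low f)) + ennreal_powr X (1 / p))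
        + ennreal ((C * 2) powr (1 / p)) * (ennreal (norm (low f)) + ennreal_powr X (1 / p))"
      by (intro add_mono 1 root) (use K X_def in simp)
    also have "\<dots> = ennreal C' * (ennreal (norm (low f)) + ennreal_powr X (1 / p))"
      unfolding C'_def by (simp only: mult_2[symmetric] mult.assoc ennreal_mult ennreal_numeral powr_ge_zero zero_le_numeral)
    finally show ?thesis by (simp add: dyadic)
  qed
  moreover have "0 < C'" using C by (simp add: C'_def)
  ultimately show ?thesis by blast
qed

lemma dyadic_le_interpolation_norm:
  assumes \<alpha>: "0 < \<alpha>" "\<alpha> < real r" and q: "1 \<le> q"
  shows "\<exists>C>0. \<forall>f. ennreal (norm f) + dyadic_norm \<alpha> q (band f)
    \<le> ennreal C * interpolation_norm (power_op r) (\<alpha> / real r) q f"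
proof (cases "q = \<infinity>")
  case True
  have r: "0 < r" using \<alpha> by (cases r) auto
  have "ennreal (coeff \<alpha> f j) \<le> (SUP t\<in>{0<..}. ennreal (t powr (- (\<alpha> / real r)) * K_functional (power_op r) t f))" for f j
  proof -
    \<comment> \<open>Sampling the supremum at the single point where the band is compared with K
      gives constant 1.\<close>
    let ?t = "2 powr (- (real j * real r)) :: real"
    have "?t powr (- (\<alpha> / real r)) = 2 powr (real j * \<alpha>)" using r by (simp add: powr_powr)
    then have "ennreal (coeff \<alpha> f j) \<le> ennreal (?t powr (- (\<alpha> / real r)) * K_functional (power_op r) ?t f)"
      by (intro ennreal_leI) (simp add: mult_left_mono norm_band_le_K)
    then show ?thesis by (rule SUP_upper2[rotated]) simp
  qed
  then have "ennreal (norm f) + dyadic_norm \<alpha> q (band f) \<le> ennreal 1 * interpolation_norm (power_op r) (\<alpha> / real r) q f" for f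
    using True by (simp add: dyadic_norm_def interpolation_norm_def SUP_least add_left_mono)
  then show ?thesis using zero_less_one by blast
next
  case False
  define p where "p = enn2real q"
  have p: "0 < p" using q False unfolding p_def
    by (cases q) (auto simp: ennreal_1[symmetric] simp del: ennreal_1)
  have r: "0 < r" using \<alpha> by (cases r) auto
  define C where "C = 1 + (2 powr (\<alpha> * p + real r)) powr (1 / p)"
  have "ennreal (norm f) + dyadic_norm \<alpha> q (band f) \<le> ennreal C * interpolation_norm (power_op r) (\<alpha> / real r) q f" for f
  proof -
    have "dyadic_norm \<alpha> q (band f) = ennreal_powr (\<Sum>j. ennreal (coeff \<alpha> f j powr p)) (1 / p)"
      using False by (simp add: dyadic_norm_def p_def)
    also have "\<dots> \<le> ennreal_powr (ennreal (2 powr (\<alpha> * p + real r)) * K_integral \<alpha> r p f) (1 / p)"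
      using p by (intro ennreal_powr_mono coeff_sum_le_K_integral \<alpha> r) auto
    also have "\<dots> = ennreal ((2 powr (\<alpha> * p + real r)) powr (1 / p)) * ennreal_powr (K_integral \<alpha> r p f) (1 / p)"
      by (rule ennreal_powr_cmult) simp
    also have "\<dots> \<le> ennreal C * ennreal_powr (K_integral \<alpha> r p f) (1 / p)"
      by (intro mult_right_mono ennreal_leI) (auto simp: C_def)
    finally have 1: "dyadic_norm \<alpha> q (band f) \<le> ennreal C * ennreal_powr (K_integral \<alpha> r p f) (1 / p)" .
    have "1 * ennreal (norm f) \<le> ennreal C * ennreal (norm f)"
      by (intro mult_right_mono) (auto simp: C_def ennreal_1[symmetric] simp del: ennreal_1 intro: ennreal_leI)
    with 1 have "ennreal (norm f) + dyadic_norm \<alpha> q (band f) \<le>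
        ennreal C * ennreal (norm f) + ennreal C * ennreal_powr (K_integral \<alpha> r p f) (1 / p)"
      by (intro add_mono) auto
    also have "\<dots> = ennreal C * interpolation_norm (power_op r) (\<alpha> / real r) q f"
      using False by (simp add: interpolation_norm_def p_def distrib_left)
    finally show ?thesis .
  qed
  moreover have "0 < C" by (simp add: C_def add_pos_nonneg)
  ultimately show ?thesis by blast
qed

text \<open>A cycle of three bounds: Besov norm by the expression with \<open>low f\<close>, this by
  the one with \<open>f\<close> since the projection contracts, and that one by the Besov norm
  again.\<close>

lemma low_band_equivalent:
  assumes \<alpha>: "0 < \<alpha>" "\<alpha> < real r" and q: "1 \<le> q"
  shows "equivalent_norms (interpolation_norm (power_op r) (\<alpha> / real r) q)
      (\<lambda>f. ennreal (norm (low f)) + dyadic_norm \<alpha> q (band f))"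
    and "equivalent_norms (interpolation_norm (power_op r) (\<alpha> / real r) q)
      (\<lambda>f. ennreal (norm f) + dyadic_norm \<alpha> q (band f))"
proof -
  let ?B = "interpolation_norm (power_op r) (\<alpha> / real r) q"
  let ?N = "\<lambda>f. ennreal (norm (low f)) + dyadic_norm \<alpha> q (band f)"
  let ?N' = "\<lambda>f. ennreal (norm f) + dyadic_norm \<alpha> q (band f)"
  obtain C1 where C1: "0 < C1" "\<And>f. ?B f \<le> ennreal C1 * ?N f"
    using interpolation_norm_le_dyadic[OF assms] by blast
  obtain C2 where C2: "0 < C2" "\<And>f. ?N' f \<le> ennreal C2 * ?B f"
    using dyadic_le_interpolation_norm[OF assms] by blast
  have N: "?N f \<le> ?N' f" for f by (intro add_mono ennreal_leI norm_low_le) simp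
  have "?B f \<le> ennreal (max C1 C2) * ?N f" "?N' f \<le> ennreal (max C1 C2) * ?B f" for f
    by (rule order_trans[OF C1(2)] order_trans[OF C2(2)], intro mult_right_mono ennreal_leI; simp)+
  moreover from this N have "?N f \<le> ennreal (max C1 C2) * ?B f" "?B f \<le> ennreal (max C1 C2) * ?N' f" for f
    by (meson order_trans mult_left_mono zero_le)+
  moreover have "0 < max C1 C2" using C1 by simp
  ultimately show "equivalent_norms ?B ?N" "equivalent_norms ?B ?N'"
    unfolding equivalent_norms_def by blast+
qed
end

lemma equivalent_norms_finite:
  "equivalent_norms M N \<Longrightarrow> M f < \<infinity> \<longleftrightarrow> N f < \<infinity>"
  unfolding equivalent_norms_def
  by (metis ennreal_less_top ennreal_mult_less_top infinity_ennreal_def le_less_trans)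

theorem lemma1p3:
  fixes \<Delta> :: "'a::{real_inner,complete_space} operator"
    and E :: "real set \<Rightarrow> 'a \<Rightarrow> 'a"
  assumes "self_adjoint \<Delta>" and "positive_definite \<Delta>"
    and "spectral_measure_of E \<Delta>"
  defines "D \<equiv> operator_powr E (1 / 2)"
  shows "\<exists>(fj :: 'a \<Rightarrow> nat \<Rightarrow> 'a) (g :: 'a \<Rightarrow> 'a).
    (\<forall>f j. fj f j \<in> paley_wiener D (2 ^ (j + 1))) \<and>
    (\<forall>f. g f \<in> paley_wiener D 1) \<and>
    (\<forall>(\<alpha>::real) (q::ennreal) (r::nat). 0 < \<alpha> \<longrightarrow> 1 \<le> q \<longrightarrow> \<alpha> < real r \<longrightarrow>
      equivalent_norms (besov_norm E r \<alpha> q)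
        (\<lambda>f. ennreal (norm (g f)) + dyadic_norm \<alpha> q (fj f)) \<and>
      equivalent_norms (besov_norm E r \<alpha> q)
        (\<lambda>f. ennreal (norm f) + dyadic_norm \<alpha> q (fj f)) \<and>
      (\<forall>f. f \<in> besov_space E r \<alpha> q \<longleftrightarrow>
        ennreal (norm (g f)) + dyadic_norm \<alpha> q (fj f) < \<infinity>) \<and>
      (\<forall>f. f \<in> besov_space E r \<alpha> q \<longleftrightarrow>
        ennreal (norm f) + dyadic_norm \<alpha> q (fj f) < \<infinity>))"
proof -
  have E: "pvm E" using assms(3) by (simp add: pvm_def spectral_measure_of_def)
  define F where "F = (\<lambda>B. E ((\<lambda>t. t powr (1 / 2)) -` B))"
  have F: "pvm F" unfolding F_def by (rule pvm_vimage[OF E]) measurable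
  \<comment> \<open>\<open>powr\<close> is nonnegative at every real argument, so the preimage of
    the half-line is the whole line and \<open>F\<close> lives on it.\<close>
  have "(\<lambda>t::real. t powr (1 / 2)) -` {0..} = UNIV" by auto
  then have "nonneg_pvm F"
    using F E by (auto simp: nonneg_pvm_def nonneg_pvm_axioms_def F_def pvm.UNIV)
  then interpret F: nonneg_pvm F .
  have "spectral_integral F (\<lambda>t. t) = D"
    unfolding F_def D_def operator_powr_def by (rule spectral_integral_vimage[OF E]) measurable
  then have FD: "spectral_measure_of F D" using F by (simp add: spectral_measure_of_def pvm_def)
  have power: "operator_powr E (real r / 2) = F.power_op r" for r
  proof -
    have "F.power_op r = spectral_integral E (\<lambda>t. (t powr (1 / 2)) powr real r)"
      unfolding F.power_op_def unfolding F_def by (rule spectral_integral_vimage[OF E]) measurable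
    then show ?thesis by (simp add: operator_powr_def powr_powr)
  qed
  \<comment> \<open>A projection for a subset of [0, \<omega>] is fixed by the one for
    [0, \<omega>]; \<open>F\<close> is the witness for the spectral measure in
    \<open>paley_wiener\<close>.\<close>
  have PW: "F B f \<in> paley_wiener D \<omega>" if "B \<in> sets borel" "B \<subseteq> {0..\<omega>}" for B f \<omega>
  proof -
    have "F {0..\<omega>} (F B f) = F B f" using that by (simp add: F.compose Int_absorb1)
    then show ?thesis unfolding paley_wiener_def using FD by (metis (mono_tags) mem_Collect_eq rangeI)
  qed
  have band: "F.band f j \<in> paley_wiener D (2 ^ (j + 1))" for f j
    unfolding F.band_def by (rule PW) (auto intro: order_trans[OF zero_le_power less_imp_le])
  have low: "F.low f \<in> paley_wiener D 1" for f
    unfolding F.low_def by (rule PW) auto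
  have equiv: "equivalent_norms (besov_norm E r \<alpha> q) (\<lambda>f. ennreal (norm (F.low f)) + dyadic_norm \<alpha> q (F.band f))"
    "equivalent_norms (besov_norm E r \<alpha> q) (\<lambda>f. ennreal (norm f) + dyadic_norm \<alpha> q (F.band f))"
    if "0 < \<alpha>" "1 \<le> q" "\<alpha> < real r" for \<alpha> q r
    unfolding besov_norm_def power using that by (intro F.low_band_equivalent; simp)+
  show ?thesis
    unfolding besov_space_def mem_Collect_eq
    by (intro exI[of _ F.band] exI[of _ F.low] conjI allI impI band low equiv
        equivalent_norms_finite[OF equiv(1)] equivalent_norms_finite[OF equiv(2)])
qed

end
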